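(* Let $R$ be a representation of $\mathfrak g$ decomposable with respect to the non compact root $\phi$, with scalars $r_\phi^\pm$, and let $\mu_R=R(\mu)$ be the moment map of $M_\phi=G/H_\phi$ in this representation. Then (for either choice of sign) $$N_\phi^*\,d\mu_R=\pm\, d\mu_R^{\mp}\,\mu_R\ \pm\ \mu_R\,d\mu_R^{\pm}\ \mp\ 2i\,r^\pm_\phi\,d\mu_R ,$$ where $d\mu_R^\pm\equiv R(C_\pm(d\mu))$.
   Context: **Setting.** Let $\mathfrak g$ be the compact form of a complex simple Lie algebra $\mathfrak g_{\mathbb C}$ of classical type, realized as a matrix algebra with $\mathfrak g=\{X\in\mathfrak g_{\mathbb C}: X^\dagger=-X\}$ (fundamental representation), and let $G$ be the corresponding compact connected matrix group. Fix a Cartan subalgebra $\mathfrak t\subset\mathfrak g$, roots $\Phi$, positive/negative roots $\Phi^\pm$, and root spaces $\mathfrak g_\alpha\subset\mathfrak g_{\mathbb C}$. Let $\phi$ be a non compact simple root: in every positive root, $\phi$ appears with coefficient $0$ (compact type, $\Phi_c^+$) or $1$ (non compact type, $\Phi^+_{nc}$). Put $\mathfrak h_\phi=\mathfrak t\oplus\bigoplus_{\alpha\in\Phi_c^+}(\mathfrak g_\alpha\oplus\mathfrak g_{-\alpha})\cap\mathfrak g$, with connected subgroup $H_\phi\subset G$; its center is one dimensional and $\rho_\phi\in Z(\mathfrak h_\phi)$ is normalized by $\phi(\rho_\phi)=i$. Identify $\mathfrak g^*\cong\mathfrak g$ by the trace form. $M_\phi=G/H_\phi$ is the adjoint orbit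 of $\rho_\phi$ through $\mu(gH_\phi)=g\rho_\phi g^{-1}$; for $X\in\mathfrak g$ put $\mu(X)={\rm Tr}(\mu X)$. The KKS Poisson bivector $\Omega_{kks}^{-1}$ is determined by $\{\mu(X),\mu(Y)\}_{kks}=\mu([X,Y])$. A bivector $\pi$ is viewed as a map $T^*M\to TM$ by $\langle\pi(\alpha),\beta\rangle=\langle\pi,\alpha\wedge\beta\rangle$, and $\Omega_{kks}:TM_\phi\to T^*M_\phi$ is the inverse of the map $\Omega_{kks}^{-1}$. **The maps $J$, $C_\pm$.** $J:\mathfrak g_{\mathbb C}\to\mathfrak g_{\mathbb C}$ is the linear map with $J|_{\mathfrak t}=0$, $J(E_\alpha)=\pm iE_\alpha$ for $E_\alpha\in\mathfrak g_\alpha$, $\alpha\in\Phi^\pm$; $C_\pm=i\pm J$; $\mathfrak b_\pm=C_\pm(\mathfrak g)$. **Bruhat-Poisson structure and Nijenhuis tensor.** $\mathfrak g_{\mathbb C}=\mathfrak g\oplus\mathfrak b_-$ with projections ${\rm pr}_{\mathfrak g,-}$, ${\rm pr}_{\mathfrak b_-}$, and $\langle A,B\rangle={\rm Im}\,{\rm Tr}(AB)$. The standard Poisson-Lie structure $\pi_G$ on $G$ is, for $\xi,\eta\in\mathfrak g\cong\mathfrak g^*$, $$\langle r_{g^{-1}}\pi_G(g),\xi\wedge\eta\rangle=\langle {\rm pr}_{\mathfrak g,-}({\rm Ad}_{g^{-1}}C_-(\xi)),\,{\rm pr}_{\mathfrak b_-}({\rm Ad}_{g^{-1}}C_-(\eta))\rangle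 ,$$ where $r_{g^{-1}}$ is right translation to the identity. $\pi_0$ is the unique Poisson structure on $M_\phi$ making $(G,\pi_G)\to (M_\phi,\pi_0)$ a Poisson map. $N_\phi=\pi_0\circ\Omega_{kks}:TM_\phi\to TM_\phi$, and $N_\phi^*:T^*M_\phi\to T^*M_\phi$ is its dual, applied entrywise to matrix-valued (complex) one-forms. **Decomposable representations.** Let $R$ be a finite dimensional representation of $\mathfrak g$ on a complex vector space $V_R$ (extended complex-linearly to $\mathfrak g_{\mathbb C}$, and integrated to the simply connected group). $R$ is decomposable with respect to $\phi$ if, $V_R=V_{R^+_\phi}\oplus V_{R^-_\phi}$ being the decomposition into eigenspaces of $R(e^{\pi\rho_\phi})$, $R(\rho_\phi)$ acts on $V_{R^\pm_\phi}$ as a scalar $r^\pm_\phi$. The labels are chosen so that $r_\phi^+-r_\phi^-=i$. *)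

theory Defs
  imports "HOL-Analysis.Analysis"
begin

section \<open>Complex matrices\<close>

definition cscale :: "complex \<Rightarrow> complex^'n^'m \<Rightarrow> complex^'n^'m"  (infixr \<open>*\<^sub>C\<close> 75)
  where "c *\<^sub>C A = (\<chi> i j. c * A $ i $ j)"

definition dagger :: "complex^'n^'m \<Rightarrow> complex^'m^'n"
  where "dagger A = (\<chi> i j. cnj (A $ j $ i))"

definition lie :: "complex^'n^'n \<Rightarrow> complex^'n^'n \<Rightarrow> complex^'n^'n"
  where "lie A B = A ** B - B ** A"

primrec mpow :: "complex^'n^'n \<Rightarrow> nat \<Rightarrow> complex^'n^'n" where
  "mpow A 0 = mat 1"
| "mpow A (Suc k) = A ** mpow A k"

definition mexp :: "complex^'n^'n \<Rightarrow> complex^'n^'n"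
  where "mexp A = (\<Sum>k. (1 / fact k :: real) *\<^sub>R mpow A k)"


section \<open>Classical simple Lie algebras, compact forms, groups\<close>

definition csubspace :: "(complex^'n^'n) set \<Rightarrow> bool"
  where "csubspace V \<longleftrightarrow> 0 \<in> V \<and> (\<forall>A\<in>V. \<forall>B\<in>V. A + B \<in> V) \<and> (\<forall>c. \<forall>A\<in>V. c *\<^sub>C A \<in> V)"

definition complex_simple_lie_algebra :: "(complex^'n^'n) set \<Rightarrow> bool"
  where "complex_simple_lie_algebra gC \<longleftrightarrow>
    csubspace gC \<and> (\<forall>A\<in>gC. \<forall>B\<in>gC. lie A B \<in> gC) \<and>
    (\<exists>A\<in>gC. \<exists>B\<in>gC. lie A B \<noteq> 0) \<and>
    (\<forall>I. csubspace I \<and> I \<subseteq> gC \<and> (\<forall>A\<in>gC. \<forall>B\<in>I. lie A B \<in> I) \<longrightarrow> I = {0} \<or> I = gC)"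

definition special_linear_algebra :: "(complex^'n^'n) set"
  where "special_linear_algebra = {A. trace A = 0}"

definition bilinear_form_algebra :: "complex^'n^'n \<Rightarrow> (complex^'n^'n) set"
  where "bilinear_form_algebra S = {A. transpose A ** S + S ** A = 0}"

text \<open>
  Types A, B, C, D in the fundamental representation. The orthogonal and symplectic algebras are
  taken with respect to an arbitrary symmetric or antisymmetric form with unitary matrix, which is
  what makes the algebra closed under \<^term>\<open>dagger\<close> and covers all the usual matrix realizations
  (identity, antidiagonal, split and symplectic forms).
\<close>

definition classical_type :: "(complex^'n^'n) set \<Rightarrow> bool"
  where "classical_type gC \<longleftrightarrow>
    gC = special_linear_algebra \<or>
    (\<exists>S. dagger S ** S = mat 1 \<and> (transpose S = S \<or> transpose S = - S) \<and>
         gC = bilinear_form_algebra S)"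

definition compact_form :: "(complex^'n^'n) set \<Rightarrow> (complex^'n^'n) set"
  where "compact_form gC = {A \<in> gC. dagger A = - A}"

text \<open>The connected matrix group with Lie algebra \<open>g\<close>: all finite products of exponentials.\<close>

inductive_set connected_group :: "(complex^'n^'n) set \<Rightarrow> (complex^'n^'n) set"
  for g :: "(complex^'n^'n) set" where
  one: "mat 1 \<in> connected_group g"
| step: "A \<in> g \<Longrightarrow> a \<in> connected_group g \<Longrightarrow> mexp A ** a \<in> connected_group g"


section \<open>Roots\<close>

text \<open>In a compact Lie algebra the Cartan subalgebras are the maximal abelian subalgebras.\<close>

definition cartan_subalgebra :: "(complex^'n^'n) set \<Rightarrow> (complex^'n^'n) set \<Rightarrow> bool"
  where "cartan_subalgebra g t \<longleftrightarrow>
    subspace t \<and> t \<subseteq> g \<and> (\<forall>H\<in>t. \<forall>K\<in>t. lie H K = 0) \<and>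
    (\<forall>A\<in>g. (\<forall>H\<in>t. lie A H = 0) \<longrightarrow> A \<in> t)"

text \<open>
  A root is the restriction to \<open>t\<close> of a root of \<open>gC\<close> (so it takes imaginary values), extended by
  \<open>0\<close> outside \<open>t\<close>. With this convention equality and sums of roots are equality and pointwise
  sums of functions.
\<close>

definition root_space ::
    "(complex^'n^'n) set \<Rightarrow> (complex^'n^'n) set \<Rightarrow> (complex^'n^'n \<Rightarrow> complex) \<Rightarrow> (complex^'n^'n) set"
  where "root_space gC t \<alpha> = {E \<in> gC. \<forall>H\<in>t. lie H E = \<alpha> H *\<^sub>C E}"

definition roots :: "(complex^'n^'n) set \<Rightarrow> (complex^'n^'n) set \<Rightarrow> (complex^'n^'n \<Rightarrow> complex) set"
  where "roots gC t =
    {\<alpha>. (\<forall>H. H \<notin> t \<longrightarrow> \<alpha> H = 0) \<and> (\<exists>H. \<alpha> H \<noteq> 0) \<and> (\<exists>E\<in>root_space gC t \<alpha>. E \<noteq> 0)}"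

definition positive_system ::
    "('a \<Rightarrow> complex) set \<Rightarrow> ('a \<Rightarrow> complex) set \<Rightarrow> bool"
  where "positive_system \<Phi> Pos \<longleftrightarrow>
    Pos \<subseteq> \<Phi> \<and> (\<forall>\<alpha>\<in>\<Phi>. (\<alpha> \<in> Pos) \<noteq> (- \<alpha> \<in> Pos)) \<and>
    (\<forall>\<alpha>\<in>Pos. \<forall>\<beta>\<in>Pos. (\<lambda>H. \<alpha> H + \<beta> H) \<in> \<Phi> \<longrightarrow> (\<lambda>H. \<alpha> H + \<beta> H) \<in> Pos)"

definition simple_roots :: "('a \<Rightarrow> complex) set \<Rightarrow> ('a \<Rightarrow> complex) set"
  where "simple_roots Pos = {\<alpha>\<in>Pos. \<not> (\<exists>\<beta>\<in>Pos. \<exists>\<gamma>\<in>Pos. \<alpha> = (\<lambda>H. \<beta> H + \<gamma> H))}"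

text \<open>The simple root \<open>\<phi>\<close> appears in \<open>\<alpha>\<close> with coefficient \<open>k\<close>.\<close>

definition appears_with ::
    "('a \<Rightarrow> complex) set \<Rightarrow> ('a \<Rightarrow> complex) \<Rightarrow> ('a \<Rightarrow> complex) \<Rightarrow> nat \<Rightarrow> bool"
  where "appears_with Pos \<phi> \<alpha> k \<longleftrightarrow>
    (\<exists>c. \<alpha> = (\<lambda>H. \<Sum>\<sigma>\<in>simple_roots Pos. of_nat (c \<sigma>) * \<sigma> H) \<and> c \<phi> = k)"

definition noncompact_simple_root :: "('a \<Rightarrow> complex) set \<Rightarrow> ('a \<Rightarrow> complex) \<Rightarrow> bool"
  where "noncompact_simple_root Pos \<phi> \<longleftrightarrow>
    \<phi> \<in> simple_roots Pos \<and> (\<forall>\<alpha>\<in>Pos. appears_with Pos \<phi> \<alpha> 0 \<or> appears_with Pos \<phi> \<alpha> 1)"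

definition compact_positive_roots :: "('a \<Rightarrow> complex) set \<Rightarrow> ('a \<Rightarrow> complex) \<Rightarrow> ('a \<Rightarrow> complex) set"
  where "compact_positive_roots Pos \<phi> = {\<alpha>\<in>Pos. appears_with Pos \<phi> \<alpha> 0}"

definition isotropy_algebra ::
    "(complex^'n^'n) set \<Rightarrow> (complex^'n^'n) set \<Rightarrow> (complex^'n^'n \<Rightarrow> complex) set \<Rightarrow>
     (complex^'n^'n \<Rightarrow> complex) \<Rightarrow> (complex^'n^'n) set"
  where "isotropy_algebra gC t Pos \<phi> =
    span (t \<union> (\<Union>\<alpha>\<in>compact_positive_roots Pos \<phi>.
      {E + F | E F. E \<in> root_space gC t \<alpha> \<and> F \<in> root_space gC t (- \<alpha>)} \<inter> compact_form gC))"

definition lie_center :: "(complex^'n^'n) set \<Rightarrow> (complex^'n^'n) set"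
  where "lie_center h = {Z\<in>h. \<forall>A\<in>h. lie Z A = 0}"

definition is_J ::
    "(complex^'n^'n) set \<Rightarrow> (complex^'n^'n) set \<Rightarrow> (complex^'n^'n \<Rightarrow> complex) set \<Rightarrow>
     (complex^'n^'n \<Rightarrow> complex^'n^'n) \<Rightarrow> bool"
  where "is_J gC t Pos J \<longleftrightarrow>
    (\<forall>A\<in>gC. J A \<in> gC) \<and>
    (\<forall>A\<in>gC. \<forall>B\<in>gC. J (A + B) = J A + J B) \<and> (\<forall>c. \<forall>A\<in>gC. J (c *\<^sub>C A) = c *\<^sub>C J A) \<and>
    (\<forall>H\<in>t. J H = 0) \<and>
    (\<forall>\<alpha>\<in>Pos. \<forall>E\<in>root_space gC t \<alpha>. J E = \<i> *\<^sub>C E) \<and>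
    (\<forall>\<alpha>\<in>Pos. \<forall>E\<in>root_space gC t (- \<alpha>). J E = (- \<i>) *\<^sub>C E)"

definition C_plus :: "(complex^'n^'n \<Rightarrow> complex^'n^'n) \<Rightarrow> complex^'n^'n \<Rightarrow> complex^'n^'n"
  where "C_plus J A = \<i> *\<^sub>C A + J A"

definition C_minus :: "(complex^'n^'n \<Rightarrow> complex^'n^'n) \<Rightarrow> complex^'n^'n \<Rightarrow> complex^'n^'n"
  where "C_minus J A = \<i> *\<^sub>C A - J A"


section \<open>Poisson geometry on submanifolds of a Euclidean space\<close>

text \<open>
  A manifold is given by a subset \<open>S\<close> of a Euclidean space together with its tangent spaces
  \<open>T x\<close>, for \<open>x \<in> S\<close>. Forms and covectors at \<open>x\<close> are functions on the ambient space that vanish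
  off \<open>T x\<close>, so that they are determined by their restriction to \<open>T x\<close>. The derivative within
  \<open>S\<close> of a function is determined on \<open>T x\<close> only, whence the cut-off in \<open>differential\<close>.
\<close>

definition differential ::
    "'a::euclidean_space set \<Rightarrow> ('a \<Rightarrow> 'a set) \<Rightarrow> ('a \<Rightarrow> 'b::real_normed_vector) \<Rightarrow> 'a \<Rightarrow> 'a \<Rightarrow> 'b"
  where "differential S T F x =
    (\<lambda>v. if v \<in> T x then frechet_derivative F (at x within S) v else 0)"

definition cotangent :: "('a::euclidean_space \<Rightarrow> 'a set) \<Rightarrow> 'a \<Rightarrow> ('a \<Rightarrow> real) set"
  where "cotangent T x =
    {a. (\<forall>v. v \<notin> T x \<longrightarrow> a v = 0) \<and>
        (\<forall>v\<in>T x. \<forall>w\<in>T x. a (v + w) = a v + a w) \<and> (\<forall>c. \<forall>v\<in>T x. a (c *\<^sub>R v) = c * a v)}"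

primrec C_k :: "nat \<Rightarrow> ('a::euclidean_space \<Rightarrow> real) \<Rightarrow> bool" where
  "C_k 0 f \<longleftrightarrow> continuous_on UNIV f"
| "C_k (Suc k) f \<longleftrightarrow>
    (\<forall>x. f differentiable (at x)) \<and> (\<forall>v. C_k k (\<lambda>x. frechet_derivative f (at x) v))"

definition smooth_fun :: "'a::euclidean_space set \<Rightarrow> ('a \<Rightarrow> real) \<Rightarrow> bool"
  where "smooth_fun S f \<longleftrightarrow> (\<exists>F. (\<forall>k. C_k k F) \<and> (\<forall>x\<in>S. F x = f x))"

text \<open>
  A bivector field \<open>P\<close> is given by the numbers \<open>P x a b = \<langle>P(x), a \<and> b\<rangle>\<close> for covectors \<open>a\<close>, \<open>b\<close>
  at \<open>x\<close>.
\<close>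

type_synonym 'a bivector_field = "'a \<Rightarrow> ('a \<Rightarrow> real) \<Rightarrow> ('a \<Rightarrow> real) \<Rightarrow> real"

definition poisson_bracket ::
    "'a::euclidean_space set \<Rightarrow> ('a \<Rightarrow> 'a set) \<Rightarrow> 'a bivector_field \<Rightarrow>
     ('a \<Rightarrow> real) \<Rightarrow> ('a \<Rightarrow> real) \<Rightarrow> 'a \<Rightarrow> real"
  where "poisson_bracket S T P f h x = P x (differential S T f x) (differential S T h x)"

definition poisson_structure ::
    "'a::euclidean_space set \<Rightarrow> ('a \<Rightarrow> 'a set) \<Rightarrow> 'a bivector_field \<Rightarrow> bool"
  where "poisson_structure S T P \<longleftrightarrow>
    (\<forall>x\<in>S. \<forall>a\<in>cotangent T x. \<forall>b\<in>cotangent T x.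
       P x a b = - P x b a \<and>
       (\<forall>a'\<in>cotangent T x. P x (\<lambda>v. a v + a' v) b = P x a b + P x a' b) \<and>
       (\<forall>c. P x (\<lambda>v. c * a v) b = c * P x a b)) \<and>
    (\<forall>f h. smooth_fun S f \<and> smooth_fun S h \<longrightarrow> smooth_fun S (poisson_bracket S T P f h)) \<and>
    (\<forall>f h k. smooth_fun S f \<and> smooth_fun S h \<and> smooth_fun S k \<longrightarrow>
       (\<forall>x\<in>S. poisson_bracket S T P f (poisson_bracket S T P h k) x
             + poisson_bracket S T P h (poisson_bracket S T P k f) x
             + poisson_bracket S T P k (poisson_bracket S T P f h) x = 0))"

definition poisson_map ::
    "'a::euclidean_space set \<Rightarrow> ('a \<Rightarrow> 'a set) \<Rightarrow> 'a bivector_field \<Rightarrow>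
     'b::euclidean_space set \<Rightarrow> ('b \<Rightarrow> 'b set) \<Rightarrow> 'b bivector_field \<Rightarrow> ('a \<Rightarrow> 'b) \<Rightarrow> bool"
  where "poisson_map S T P S' T' P' p \<longleftrightarrow>
    (\<forall>x\<in>S. p x \<in> S') \<and>
    (\<forall>f h. smooth_fun S' f \<and> smooth_fun S' h \<longrightarrow>
       (\<forall>x\<in>S. poisson_bracket S T P (f \<circ> p) (h \<circ> p) x = poisson_bracket S' T' P' f h (p x)))"

text \<open>The map from covectors to tangent vectors: \<open>\<langle>P(a), b\<rangle> = \<langle>P, a \<and> b\<rangle>\<close>.\<close>

definition sharp ::
    "('a::euclidean_space \<Rightarrow> 'a set) \<Rightarrow> 'a bivector_field \<Rightarrow> 'a \<Rightarrow> ('a \<Rightarrow> real) \<Rightarrow> 'a"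
  where "sharp T P x a = (THE v. v \<in> T x \<and> (\<forall>b\<in>cotangent T x. b v = P x a b))"

text \<open>The map from tangent vectors to covectors inverse to \<open>sharp\<close>, for nondegenerate \<open>P\<close>.\<close>

definition symplectic_flat ::
    "('a::euclidean_space \<Rightarrow> 'a set) \<Rightarrow> 'a bivector_field \<Rightarrow> 'a \<Rightarrow> 'a \<Rightarrow> ('a \<Rightarrow> real)"
  where "symplectic_flat T P x v = (THE a. a \<in> cotangent T x \<and> sharp T P x a = v)"

definition nijenhuis ::
    "('a::euclidean_space \<Rightarrow> 'a set) \<Rightarrow> 'a bivector_field \<Rightarrow> 'a bivector_field \<Rightarrow> 'a \<Rightarrow> 'a \<Rightarrow> 'a"
  where "nijenhuis T P0 Pkks x v = sharp T P0 x (symplectic_flat T Pkks x v)"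

definition dual_map :: "('a \<Rightarrow> 'a \<Rightarrow> 'a) \<Rightarrow> ('a \<Rightarrow> 'a \<Rightarrow> 'b) \<Rightarrow> 'a \<Rightarrow> 'a \<Rightarrow> 'b"
  where "dual_map N \<theta> x v = \<theta> x (N x v)"


section \<open>The group and the adjoint orbit\<close>

definition group_tangent :: "(complex^'n^'n) set \<Rightarrow> complex^'n^'n \<Rightarrow> (complex^'n^'n) set"
  where "group_tangent g a = {A ** a | A. A \<in> g}"

definition orbit_map :: "complex^'n^'n \<Rightarrow> complex^'n^'n \<Rightarrow> complex^'n^'n"
  where "orbit_map \<rho> a = a ** \<rho> ** matrix_inv a"

definition adjoint_orbit :: "(complex^'n^'n) set \<Rightarrow> complex^'n^'n \<Rightarrow> (complex^'n^'n) set"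
  where "adjoint_orbit G \<rho> = orbit_map \<rho> ` G"

text \<open>The tangent space at \<open>x\<close> consists of the velocities at \<open>s = 0\<close> of \<open>exp(sA) x exp(-sA)\<close>.\<close>

definition orbit_tangent :: "(complex^'n^'n) set \<Rightarrow> complex^'n^'n \<Rightarrow> (complex^'n^'n) set"
  where "orbit_tangent g x = {lie A x | A. A \<in> g}"

text \<open>The function \<open>Tr (x A)\<close> on the orbit; the trace is real for \<open>x\<close>, \<open>A\<close> antihermitian.\<close>

definition moment_component :: "complex^'n^'n \<Rightarrow> complex^'n^'n \<Rightarrow> real"
  where "moment_component A x = Re (trace (x ** A))"

definition is_kks ::
    "(complex^'n^'n) set \<Rightarrow> (complex^'n^'n) set \<Rightarrow> (complex^'n^'n) bivector_field \<Rightarrow> bool"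
  where "is_kks g M P \<longleftrightarrow>
    poisson_structure M (orbit_tangent g) P \<and>
    (\<forall>A\<in>g. \<forall>B\<in>g. \<forall>x\<in>M.
       poisson_bracket M (orbit_tangent g) P (moment_component A) (moment_component B) x
         = moment_component (lie A B) x)"

definition pr_g ::
    "(complex^'n^'n) set \<Rightarrow> (complex^'n^'n \<Rightarrow> complex^'n^'n) \<Rightarrow> complex^'n^'n \<Rightarrow> complex^'n^'n"
  where "pr_g g J A = (THE X. X \<in> g \<and> A - X \<in> C_minus J ` g)"

definition pr_b ::
    "(complex^'n^'n) set \<Rightarrow> (complex^'n^'n \<Rightarrow> complex^'n^'n) \<Rightarrow> complex^'n^'n \<Rightarrow> complex^'n^'n"
  where "pr_b g J A = (THE B. B \<in> C_minus J ` g \<and> A - B \<in> g)"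

text \<open>
  The element \<open>\<xi>\<close> of \<open>g\<close> that corresponds under the trace form to the covector \<open>a\<close> at \<open>u \<in> G\<close>
  translated on the right to the identity.
\<close>

definition right_trivialize ::
    "(complex^'n^'n) set \<Rightarrow> complex^'n^'n \<Rightarrow> (complex^'n^'n \<Rightarrow> real) \<Rightarrow> complex^'n^'n"
  where "right_trivialize g u a = (THE \<xi>. \<xi> \<in> g \<and> (\<forall>A\<in>g. Re (trace (\<xi> ** A)) = a (A ** u)))"

definition poisson_lie ::
    "(complex^'n^'n) set \<Rightarrow> (complex^'n^'n \<Rightarrow> complex^'n^'n) \<Rightarrow> (complex^'n^'n) bivector_field"
  where "poisson_lie g J u a b =
    (let \<xi> = right_trivialize g u a; \<eta> = right_trivialize g u b in
     Im (trace (pr_g g J (matrix_inv u ** C_minus J \<xi> ** u) **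
                pr_b g J (matrix_inv u ** C_minus J \<eta> ** u))))"


section \<open>Representations\<close>

definition lie_representation ::
    "(complex^'n^'n) set \<Rightarrow> (complex^'n^'n \<Rightarrow> complex^'m^'m) \<Rightarrow> bool"
  where "lie_representation g R \<longleftrightarrow>
    (\<forall>A\<in>g. \<forall>B\<in>g. R (A + B) = R A + R B) \<and>
    (\<forall>c::real. \<forall>A\<in>g. R (c *\<^sub>R A) = c *\<^sub>R R A) \<and>
    (\<forall>A\<in>g. \<forall>B\<in>g. R (lie A B) = lie (R A) (R B))"

text \<open>
  The complex linear extension \<open>R X + i R Y\<close> at \<open>A = X + i Y\<close>, where \<open>X = (A - dagger A) / 2\<close> and
  \<open>Y = (A + dagger A) / (2 i)\<close> are antihermitian.
\<close>

definition complex_extension ::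
    "(complex^'n^'n \<Rightarrow> complex^'m^'m) \<Rightarrow> complex^'n^'n \<Rightarrow> complex^'m^'m"
  where "complex_extension R A =
    R ((1/2) *\<^sub>C (A - dagger A)) + \<i> *\<^sub>C R ((1 / (2 * \<i>)) *\<^sub>C (A + dagger A))"

text \<open>
  The value at \<open>exp(\<pi> \<rho>)\<close> of the representation of the simply connected group integrating \<open>R\<close> is
  the matrix exponential of \<open>\<pi> R(\<rho>)\<close>.
\<close>

definition decomposable ::
    "(complex^'n^'n \<Rightarrow> complex^'m^'m) \<Rightarrow> complex^'n^'n \<Rightarrow> complex \<Rightarrow> complex \<Rightarrow> bool"
  where "decomposable R \<rho> rp rm \<longleftrightarrow>
    (\<exists>lp lm. let Vp = {v. mexp (pi *\<^sub>R R \<rho>) *v v = lp *s v};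
                 Vm = {v. mexp (pi *\<^sub>R R \<rho>) *v v = lm *s v} in
       (\<forall>v. \<exists>a\<in>Vp. \<exists>b\<in>Vm. v = a + b) \<and> Vp \<inter> Vm = {0} \<and>
       (\<forall>v\<in>Vp. R \<rho> *v v = rp *s v) \<and> (\<forall>v\<in>Vm. R \<rho> *v v = rm *s v)) \<and>
    rp - rm = \<i>"

end

theory Submission
  imports Defs
begin

text \<open>
  At \<open>x = u \<rho> u\<^sup>-\<^sup>1\<close> the covector \<open>d\<mu>(A)\<close>, pulled back to \<open>G\<close> and translated to the identity, is
  \<open>\<xi> = [x, A]\<close>. Because \<open>Ad u\<^sup>-\<^sup>1 (C\<^sub>- \<xi>) = i \<xi>' - Ad u\<^sup>-\<^sup>1 (J \<xi>)\<close> with \<open>\<xi>' = Ad u\<^sup>-\<^sup>1 \<xi>\<close>, its projections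
  along \<open>g \<oplus> b\<^sub>-\<close> are \<open>J \<xi>' - Ad u\<^sup>-\<^sup>1 (J \<xi>)\<close> and \<open>C\<^sub>- \<xi>'\<close>. All positive roots take the value \<open>0\<close> or \<open>i\<close>
  at \<open>\<rho>\<close>, so \<open>J = ad \<rho>\<close> and \<open>(ad \<rho>)\<^sup>2 = -1\<close> on \<open>[\<rho>, g]\<close>; this turns the Bruhat-Poisson bivector into
  an expression in \<open>x\<close> alone and gives \<open>N v = v + [x, J v]\<close>. In a decomposable representation
  \<open>m = R x\<close> satisfies \<open>m\<^sup>2 = (r\<^sub>+ + r\<^sub>-) m - r\<^sub>+ r\<^sub>-\<close>, hence \<open>m dm + dm m = (r\<^sub>+ + r\<^sub>-) dm\<close>, and both
  formulas reduce to \<open>dm + [m, R (J v)]\<close>.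
\<close>

section \<open>Complex matrices\<close>

lemma matrix_add_rdistrib: "(D + E) ** C = D ** C + E ** (C :: 'a::ring_1^'n^'m)"
  and matrix_diff_ldistrib: "A ** (B - C) = A ** B - A ** (C :: 'a::ring_1^'n^'m)"
  and matrix_diff_rdistrib: "(D - E) ** C = D ** C - E ** (C :: 'a::ring_1^'n^'m)"
  and matrix_uminus_left: "(- D) ** C = - (D ** C)"
  and matrix_uminus_right: "A ** (- C) = - (A ** C)"
  by (simp_all add: matrix_matrix_mult_def vec_eq_iff algebra_simps sum_subtractf sum_negf sum.distrib)

lemma matrix_mul_zero_left [simp]: "0 ** (C :: 'a::ring_1^'n^'m) = 0"
  and matrix_mul_zero_right [simp]: "D ** (0 :: 'a::ring_1^'n^'m) = 0"
  by (simp_all add: matrix_matrix_mult_def vec_eq_iff)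

lemma matrix_scaleR_left: "(r *\<^sub>R A) ** B = r *\<^sub>R (A ** (B :: complex^'n^'m))"
  and matrix_scaleR_right: "A ** (r *\<^sub>R B) = r *\<^sub>R (A ** B)"
  by (simp_all add: matrix_matrix_mult_def vec_eq_iff scaleR_sum_right)

lemma cscale_nth [simp]: "(c *\<^sub>C A) $ i $ j = c * A $ i $ j"
  by (simp add: cscale_def)

lemma cscale_mult_left: "(c *\<^sub>C A) ** B = c *\<^sub>C (A ** B)"
  and cscale_mult_right: "A ** (c *\<^sub>C B) = c *\<^sub>C (A ** B)"
  by (simp_all add: matrix_matrix_mult_def vec_eq_iff sum_distrib_left mult_ac)

lemma cscale_add: "c *\<^sub>C (A + B) = c *\<^sub>C A + c *\<^sub>C B"
  and cscale_diff: "c *\<^sub>C (A - B) = c *\<^sub>C A - c *\<^sub>C B"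
  and cscale_uminus: "c *\<^sub>C (- A) = - (c *\<^sub>C A)"
  and cscale_uminus_left: "(- c) *\<^sub>C A = - (c *\<^sub>C A)"
  and cscale_cscale: "c *\<^sub>C d *\<^sub>C A = (c * d) *\<^sub>C A"
  by (simp_all add: vec_eq_iff algebra_simps scaleR_conv_of_real[where 'a = complex])

lemma cscale_zero [simp]: "c *\<^sub>C 0 = 0" "0 *\<^sub>C A = 0" "1 *\<^sub>C A = A"
  by (simp_all add: vec_eq_iff)

lemma cscale_of_real: "of_real r *\<^sub>C A = r *\<^sub>R A"
  by (simp add: vec_eq_iff scaleR_conv_of_real[where 'a = complex])

lemma cscale_eq_0_iff [simp]: "c *\<^sub>C A = 0 \<longleftrightarrow> c = 0 \<or> A = 0"
  by (auto simp: vec_eq_iff)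

lemma trace_cscale: "trace (c *\<^sub>C A) = c * trace A"
  by (simp add: trace_def sum_distrib_left)

lemma trace_scaleR: "trace (r *\<^sub>R A) = r *\<^sub>R trace (A :: complex^'n^'n)"
  by (simp add: trace_def scaleR_sum_right)

lemma trace_uminus: "trace (- A) = - trace (A :: complex^'n^'n)"
  by (simp add: trace_def sum_negf)

lemmas matrix_ring_simps = matrix_add_ldistrib matrix_add_rdistrib matrix_diff_ldistrib
  matrix_diff_rdistrib matrix_uminus_left matrix_uminus_right matrix_mul_assoc
  matrix_scaleR_left matrix_scaleR_right cscale_mult_left cscale_mult_right

lemma dagger_nth [simp]: "dagger A $ i $ j = cnj (A $ j $ i)"
  by (simp add: dagger_def)

lemma dagger_mult: "dagger (A ** B) = dagger B ** dagger A"
  by (simp add: matrix_matrix_mult_def vec_eq_iff mult.commute)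

lemma dagger_add: "dagger (A + B) = dagger A + dagger B"
  and dagger_diff: "dagger (A - B) = dagger A - dagger B"
  and dagger_uminus: "dagger (- A) = - dagger A"
  and dagger_scaleR: "dagger (r *\<^sub>R A) = r *\<^sub>R dagger A"
  and dagger_cscale: "dagger (c *\<^sub>C A) = cnj c *\<^sub>C dagger A"
  and dagger_dagger [simp]: "dagger (dagger A) = A"
  and dagger_0 [simp]: "dagger 0 = 0"
  by (simp_all add: vec_eq_iff)

lemma dagger_mat_1 [simp]: "dagger (mat 1) = mat 1"
  by (simp add: vec_eq_iff mat_def)

lemmas dagger_simps = dagger_mult dagger_add dagger_diff dagger_uminus dagger_scaleR dagger_cscale

text \<open>The Euclidean inner product of the matrix type is the real Hilbert-Schmidt product, so
  orthogonal complements and adjoints can be handled by trace identities.\<close>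

lemma inner_eq_trace: "A \<bullet> B = Re (trace (dagger A ** B))" for A B :: "complex^'n^'m"
proof -
  have "Re (trace (dagger A ** B)) = (\<Sum>j\<in>UNIV. \<Sum>i\<in>UNIV. A $ i $ j \<bullet> B $ i $ j)"
    by (simp add: trace_def matrix_matrix_mult_def inner_complex_def)
  also have "\<dots> = (\<Sum>i\<in>UNIV. \<Sum>j\<in>UNIV. A $ i $ j \<bullet> B $ i $ j)"
    by (rule sum.swap)
  finally show ?thesis by (simp add: inner_vec_def)
qed

lemma trace_dagger: "trace (dagger A) = cnj (trace A)"
  by (simp add: trace_def)

section \<open>Brackets and their interplay with the trace form\<close>

lemma lie_add_left: "lie (A + B) C = lie A C + lie B C"
  and lie_add_right: "lie A (B + C) = lie A B + lie A C"
  and lie_diff_right: "lie A (B - C) = lie A B - lie A C"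
  and lie_diff_left: "lie (A - B) C = lie A C - lie B C"
  and lie_scaleR_left: "lie (r *\<^sub>R A) B = r *\<^sub>R lie A B"
  and lie_scaleR_right: "lie A (r *\<^sub>R B) = r *\<^sub>R lie A B"
  and lie_cscale_left: "lie (c *\<^sub>C A) B = c *\<^sub>C lie A B"
  and lie_cscale_right: "lie A (c *\<^sub>C B) = c *\<^sub>C lie A B"
  and lie_uminus_left: "lie (- A) B = - lie A B"
  and lie_uminus_right: "lie A (- B) = - lie A B"
  by (simp_all add: lie_def matrix_ring_simps algebra_simps scaleR_diff_right cscale_diff)

lemma lie_commute: "lie A B = - lie B A"
  by (simp add: lie_def)

lemma lie_zero [simp]: "lie A 0 = 0" "lie 0 A = 0"
  by (simp_all add: lie_def)

lemma lie_jacobi: "lie A (lie B C) = lie (lie A B) C + lie B (lie A C)"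
  by (simp add: lie_def matrix_ring_simps)

lemma dagger_lie: "dagger (lie A B) = - lie (dagger A) (dagger B)"
  by (simp add: lie_def dagger_simps)

lemma trace_lie: "trace (lie A B ** C) = trace (B ** lie C A)"
proof -
  have "trace (A ** B ** C) = trace (B ** (C ** A))"
    by (metis trace_mul_sym matrix_mul_assoc)
  then show ?thesis
    by (simp add: lie_def matrix_ring_simps trace_sub)
qed

text \<open>This is what makes i ad H selfadjoint and what keeps orthogonal complements stable under
  a Cartan subalgebra.\<close>

lemma inner_lie_antihermitian: "dagger H = - H \<Longrightarrow> lie H A \<bullet> B = - (A \<bullet> lie H B)"
  by (simp add: inner_eq_trace dagger_lie lie_uminus_left trace_lie[of H])
     (simp add: lie_commute[of B] matrix_ring_simps trace_uminus)

lemma inner_antihermitian: "dagger A = - A \<Longrightarrow> A \<bullet> B = - Re (trace (A ** B))"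
  by (simp add: inner_eq_trace matrix_ring_simps trace_uminus)

lemma trace_antihermitian_real: "dagger A = - A \<Longrightarrow> dagger B = - B \<Longrightarrow> Im (trace (A ** B)) = 0"
proof -
  assume "dagger A = - A" "dagger B = - B"
  then have "cnj (trace (A ** B)) = trace (B ** A)"
    by (simp flip: trace_dagger add: dagger_mult matrix_ring_simps)
  then show ?thesis
    by (simp add: complex_eq_iff trace_mul_sym[of B])
qed

text \<open>Supplies the product rules by which products of matrix curves are
  differentiated.\<close>

interpretation matrix_mult: bounded_bilinear
  "(**) :: complex^'n^'m \<Rightarrow> complex^'k^'n \<Rightarrow> complex^'k^'m"
  by (simp add: bilinear_conv_bounded_bilinear[symmetric] bilinear_def linear_iff matrix_ring_simps)

lemma bounded_linear_dagger: "bounded_linear (dagger :: complex^'n^'m \<Rightarrow> _)"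
  by (simp add: linear_conv_bounded_linear[symmetric] linear_iff dagger_simps)

lemma bounded_linear_transpose: "bounded_linear (transpose :: complex^'n^'m \<Rightarrow> _)"
  by (simp add: linear_conv_bounded_linear[symmetric] linear_iff transpose_def vec_eq_iff)

lemma bounded_linear_trace: "bounded_linear (trace :: complex^'n^'n \<Rightarrow> _)"
  by (simp add: linear_conv_bounded_linear[symmetric] linear_iff trace_add trace_scaleR)

section \<open>The matrix exponential\<close>

lemma mpow_scaleR: "mpow (r *\<^sub>R A) k = r ^ k *\<^sub>R mpow A k"
  by (induction k) (simp_all add: matrix_ring_simps)

lemma mpow_commute: "A ** mpow A k = mpow A k ** A"
  by (induction k) (simp_all add: matrix_ring_simps)

text \<open>\<open>K\<close> bounds left multiplication by \<open>A\<close>, and \<open>c\<close> is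
  the norm of the identity matrix.\<close>

lemma mpow_norm_bound: "\<exists>c K. \<forall>k. norm (mpow A k) \<le> c * K ^ k"
proof -
  obtain K where K: "0 < K" "\<And>B::complex^'a^'a. norm (A ** B) \<le> norm B * K"
    using bounded_linear.pos_bounded[OF matrix_mult.bounded_linear_right[of A]] by blast
  have "norm (mpow A k) \<le> norm (mat 1 :: complex^'a^'a) * K ^ k" for k
  proof (induction k)
    case (Suc k)
    have "norm (mpow A (Suc k)) \<le> norm (mpow A k) * K"
      using K by simp
    also have "\<dots> \<le> norm (mat 1 :: complex^'a^'a) * K ^ k * K"
      using Suc K by (intro mult_right_mono) auto
    finally show ?case by (simp add: mult_ac)
  qed simp
  then show ?thesis by blast
qed

lemma summable_mexp: "summable (\<lambda>k. (1 / fact k :: real) *\<^sub>R mpow A k)"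
proof -
  obtain c K where cK: "norm (mpow A k) \<le> c * K ^ k" for k
    using mpow_norm_bound by blast
  have "summable (\<lambda>k. c * (inverse (fact k) * K ^ k))"
    by (intro summable_mult summable_exp)
  then show ?thesis
    by (rule summable_comparison_test'[where N = 0])
       (use cK in \<open>auto simp: field_simps\<close>)
qed

lemma mexp_0 [simp]: "mexp 0 = mat 1"
proof -
  have "(\<lambda>k. (1 / fact k :: real) *\<^sub>R mpow 0 k) = (\<lambda>k. if k = 0 then mat 1 else 0 :: complex^'a^'a)"
  proof
    fix k show "(1 / fact k :: real) *\<^sub>R mpow 0 k = (if k = 0 then mat 1 else 0 :: complex^'a^'a)"
      by (cases k) auto
  qed
  then show ?thesis
    using sums_If_finite_set[of "{0}" "\<lambda>_. mat 1 :: complex^'a^'a"]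
    by (simp add: mexp_def sums_iff)
qed

lemma mexp_commute: "A ** mexp (s *\<^sub>R A) = mexp (s *\<^sub>R A) ** A"
proof -
  have "A ** mexp (s *\<^sub>R A) = (\<Sum>k. A ** ((1 / fact k :: real) *\<^sub>R mpow (s *\<^sub>R A) k))"
    unfolding mexp_def
    by (rule bounded_linear.suminf[OF matrix_mult.bounded_linear_right summable_mexp])
  also have "\<dots> = (\<Sum>k. ((1 / fact k :: real) *\<^sub>R mpow (s *\<^sub>R A) k) ** A)"
    by (simp add: mpow_scaleR matrix_ring_simps mpow_commute)
  also have "\<dots> = mexp (s *\<^sub>R A) ** A"
    unfolding mexp_def
    by (rule bounded_linear.suminf[OF matrix_mult.bounded_linear_left summable_mexp, symmetric])
  finally show ?thesis .
qed

lemma mexp_nth_sums: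
  "(\<lambda>k. (mpow A k $ i $ j / fact k) * of_real s ^ k) sums (mexp (s *\<^sub>R A) $ i $ j)"
proof -
  have "(\<lambda>k. (1 / fact k :: real) *\<^sub>R mpow (s *\<^sub>R A) k) sums mexp (s *\<^sub>R A)"
    unfolding mexp_def using summable_mexp by (rule summable_sums)
  then have "(\<lambda>k. ((1 / fact k :: real) *\<^sub>R mpow (s *\<^sub>R A) k) $ i $ j) sums (mexp (s *\<^sub>R A) $ i $ j)"
    by (intro bounded_linear.sums[OF bounded_linear_vec_nth])
  then show ?thesis
    by (simp add: mpow_scaleR scaleR_conv_of_real[where 'a = complex] field_simps)
qed

text \<open>Applied twice, to rows and then to entries, it reduces a matrix curve to scalar
  functions.\<close>

lemma has_vector_derivative_vec:
  fixes f :: "real \<Rightarrow> 'a::euclidean_space^'n"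
  assumes "\<And>i. ((\<lambda>s. f s $ i) has_vector_derivative d $ i) (at s within S)"
  shows "(f has_vector_derivative d) (at s within S)"
  unfolding has_vector_derivative_def
  by (subst has_derivative_componentwise_within)
    (use assms in \<open>auto simp: Basis_vec_def inner_axis has_vector_derivative_def
      intro!: has_derivative_inner_left[THEN has_derivative_eq_rhs]\<close>)

text \<open>Each entry of the exponential is an everywhere convergent power series in s and can be
  differentiated term by term.\<close>

lemma mexp_has_vector_derivative:
  "((\<lambda>s. mexp (s *\<^sub>R A)) has_vector_derivative A ** mexp (s *\<^sub>R A)) (at s within S)"
proof (intro has_vector_derivative_vec)
  fix i j
  define c where "c = (\<lambda>j k. mpow A k $ i $ j / fact k)"
  have sums: "(\<lambda>k. c j k * of_real s ^ k) sums (mexp (s *\<^sub>R A) $ i $ j)" for j s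
    unfolding c_def by (rule mexp_nth_sums)
  obtain b K where bK: "norm (mpow A k) \<le> b * K ^ k" for k
    using mpow_norm_bound by blast
  have summable: "summable (\<lambda>k. c j k * z ^ k)" for z
  proof (rule summable_comparison_test'[where N = 0])
    show "summable (\<lambda>k. b * (inverse (fact k) * (K * norm z) ^ k))"
      by (intro summable_mult summable_exp)
    fix k
    have "norm (mpow A k $ i $ j) \<le> b * K ^ k"
      using bK[of k] component_le_norm_cart order_trans Finite_Cartesian_Product.norm_nth_le
      by (metis (no_types))
    from mult_left_mono[OF this, of "cmod z ^ k"]
    show "norm (c j k * z ^ k) \<le> b * (inverse (fact k) * (K * norm z) ^ k)"
      by (simp add: c_def norm_mult norm_divide norm_power field_simps power_mult_distrib)
  qed
  have "((\<lambda>s. \<Sum>k. c j k * of_real s ^ k) has_vector_derivative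
      (\<Sum>k. diffs (c j) k * of_real s ^ k)) (at s within S)"
    by (intro has_vector_derivative_real_field termdiffs_strong_converges_everywhere summable)
  moreover have "(\<lambda>k. diffs (c j) k * of_real s ^ k) sums ((A ** mexp (s *\<^sub>R A)) $ i $ j)"
  proof -
    \<comment> \<open>The shift in \<open>diffs\<close> cancels one factor of the factorial and
      leaves one more factor \<open>A\<close>, which \<open>mpow_commute\<close> moves to the
      right.\<close>
    have "diffs (c j) k * of_real s ^ k = ((1 / fact k :: real) *\<^sub>R (mpow (s *\<^sub>R A) k ** A)) $ i $ j" for k
    proof -
      have "diffs (c j) k = mpow A (Suc k) $ i $ j / fact k"
        by (simp add: diffs_def c_def of_nat_Suc[symmetric] del: of_nat_Suc)
      then show ?thesis
        by (simp add: mpow_scaleR mpow_commute matrix_ring_simps scaleR_conv_of_real[where 'a = complex] field_simps)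
    qed
    moreover have "(\<lambda>k. ((1 / fact k :: real) *\<^sub>R mpow (s *\<^sub>R A) k) ** A) sums (mexp (s *\<^sub>R A) ** A)"
      unfolding mexp_def
      by (intro bounded_linear.sums[OF matrix_mult.bounded_linear_left] summable_sums summable_mexp)
    then have "(\<lambda>k. (((1 / fact k :: real) *\<^sub>R mpow (s *\<^sub>R A) k) ** A) $ i $ j) sums
        ((mexp (s *\<^sub>R A) ** A) $ i $ j)"
      by (intro bounded_linear.sums[OF bounded_linear_vec_nth])
    ultimately show ?thesis
      by (simp add: mexp_commute matrix_scaleR_left)
  qed
  ultimately show "((\<lambda>s. mexp (s *\<^sub>R A) $ i $ j) has_vector_derivative (A ** mexp (s *\<^sub>R A)) $ i $ j) (at s within S)"
    using sums by (simp add: sums_iff)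
qed

section \<open>Root space decomposition\<close>

lemma csubspace_imp_subspace: "csubspace V \<Longrightarrow> subspace V"
  unfolding csubspace_def subspace_def by (metis cscale_of_real)

lemma csubspace_uminus: "csubspace V \<Longrightarrow> A \<in> V \<Longrightarrow> - A \<in> V"
  using csubspace_imp_subspace subspace_neg by blast

lemma inner_cscale_imaginary: "(\<i> *\<^sub>C A) \<bullet> B = - (A \<bullet> (\<i> *\<^sub>C B))"
  by (simp add: inner_eq_trace dagger_cscale cscale_mult_left cscale_mult_right trace_cscale)

text \<open>Maximize the quadratic form of \<open>B\<close> on the unit sphere of \<open>W\<close>.
  Moving from the maximum \<open>v\<close> in the direction l v - B v shows that this vector
  vanishes.\<close>

lemma selfadjoint_eigenvector:
  fixes B :: "'a::euclidean_space \<Rightarrow> 'a"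
  assumes W: "subspace W" "W \<noteq> {0}" and B: "linear B" "B ` W \<subseteq> W"
    and sym: "\<And>v w. v \<in> W \<Longrightarrow> w \<in> W \<Longrightarrow> B v \<bullet> w = v \<bullet> B w"
  obtains v l where "v \<in> W" "v \<noteq> 0" "B v = l *\<^sub>R v"
proof -
  define K where "K = W \<inter> sphere 0 1"
  have "compact K"
    unfolding K_def by (intro closed_Int_compact closed_subspace W) auto
  moreover obtain w where w: "w \<in> W" "w \<noteq> 0"
    using W subspace_0 by blast
  then have "(1 / norm w) *\<^sub>R w \<in> K"
    by (auto simp: K_def intro!: subspace_scale W)
  moreover have "continuous_on K (\<lambda>v. B v \<bullet> v)"
    by (intro continuous_intros linear_continuous_on linear_conv_bounded_linear[THEN iffD1] B)
  ultimately obtain v where v: "v \<in> K" and max: "\<And>u. u \<in> K \<Longrightarrow> B u \<bullet> u \<le> B v \<bullet> v"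
    using continuous_attains_sup[of K "\<lambda>v. B v \<bullet> v"] by blast
  define l where "l = B v \<bullet> v"
  define q where "q = (\<lambda>u. l * (u \<bullet> u) - B u \<bullet> u)"
  have vW: "v \<in> W" and v1: "v \<bullet> v = 1"
    using v by (auto simp: K_def dot_square_norm)
  have q_nonneg: "0 \<le> q u" if "u \<in> W" for u
  proof (cases "u = 0")
    case False
    have "(1 / norm u) *\<^sub>R u \<in> K"
      using that False by (auto simp: K_def intro!: subspace_scale W)
    from max[OF this] have "B u \<bullet> u \<le> l * (norm u)\<^sup>2"
      using False by (simp add: linear_cmul[OF B(1)] l_def power2_eq_square divide_simps)
    then show ?thesis by (simp add: q_def dot_square_norm)
  qed (simp add: q_def linear_0[OF B(1)])
  \<comment> \<open>Up to a factor 2 this is the gradient at \<open>v\<close>, within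
    \<open>W\<close>, of q, which is nonnegative on \<open>W\<close> and zero at
    \<open>v\<close>.\<close>
  define w where "w = l *\<^sub>R v - B v"
  have wW: "w \<in> W"
    unfolding w_def using B(2) vW W(1) by (auto intro!: subspace_diff subspace_scale)
  have expand: "q (v + s *\<^sub>R w) = 2 * s * (w \<bullet> w) + s\<^sup>2 * q w" for s
  proof -
    have "B w \<bullet> v = B v \<bullet> w"
      using sym[OF wW vW] by (simp add: inner_commute)
    moreover have "s * (w \<bullet> w) = s * (l * (v \<bullet> w) - B v \<bullet> w)"
      by (metis inner_diff_left inner_scaleR_left w_def)
    moreover have "w \<bullet> v = v \<bullet> w" by (rule inner_commute)
    moreover have "l * (v \<bullet> v) - B v \<bullet> v = 0"
      by (simp add: v1 l_def)
    ultimately show ?thesis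
      unfolding q_def linear_add[OF B(1)] linear_cmul[OF B(1)]
      by (simp add: inner_add_left inner_add_right power2_eq_square algebra_simps)
  qed
  have "w \<bullet> w = 0"
  proof (rule ccontr)
    assume "w \<bullet> w \<noteq> 0"
    then have pos: "w \<bullet> w > 0" by (simp add: less_le)
    \<comment> \<open>With this step length s (q w) is at most w . w, so the linear term -2 s (w .
      w) dominates and q would be negative at v - s w.\<close>
    define s where "s = (w \<bullet> w) / (1 + q w)"
    have qw: "0 \<le> q w" using q_nonneg wW .
    then have s: "s > 0" using pos by (simp add: s_def)
    have "0 \<le> q (v + (- s) *\<^sub>R w)"
      by (intro q_nonneg subspace_add subspace_scale W vW wW)
    then have "2 * s * (w \<bullet> w) \<le> s * (s * q w)"
      unfolding expand by (simp add: power2_eq_square)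
    then have "2 * (w \<bullet> w) \<le> s * q w"
      using s by simp
    also have "s * q w \<le> w \<bullet> w"
      using pos qw by (simp add: s_def divide_simps)
    finally show False using pos by simp
  qed
  then have "B v = l *\<^sub>R v" by (simp add: w_def)
  moreover have "v \<noteq> 0" using v1 by auto
  ultimately show thesis using that vW by blast
qed

text \<open>Take a nonzero invariant complex subspace of least dimension. Since \<open>t\<close> is
  abelian, an eigenspace of ad H in it is again invariant, hence is everything; so every ad H acts
  on it as a scalar.\<close>

lemma common_eigenvector:
  fixes W :: "(complex^'n^'n) set"
  assumes W: "csubspace W" "W \<noteq> {0}"
    and inv: "\<forall>H\<in>t. \<forall>A\<in>W. lie H A \<in> W"
    and anti: "\<forall>H\<in>t. dagger H = - H"
    and comm: "\<forall>H\<in>t. \<forall>K\<in>t. lie H K = 0"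
  shows "\<exists>E \<alpha>. E \<in> W \<and> E \<noteq> 0 \<and> (\<forall>H\<in>t. lie H E = \<alpha> H *\<^sub>C E)"
proof -
  define P where "P = (\<lambda>V. csubspace V \<and> V \<subseteq> W \<and> V \<noteq> {0} \<and> (\<forall>H\<in>t. \<forall>A\<in>V. lie H A \<in> V))"
  have "P W" using W inv by (auto simp: P_def)
  then obtain V where V: "P V" and min: "\<And>V'. P V' \<Longrightarrow> dim V \<le> dim V'"
    using ex_has_least_nat[of P W dim] by blast
  have cV: "csubspace V" and VW: "V \<subseteq> W" and V0: "V \<noteq> {0}"
    and Vinv: "\<And>H A. H \<in> t \<Longrightarrow> A \<in> V \<Longrightarrow> lie H A \<in> V"
    using V by (auto simp: P_def)
  have sV: "subspace V" using cV by (rule csubspace_imp_subspace)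
  have "\<exists>c. \<forall>A\<in>V. lie H A = c *\<^sub>C A" if H: "H \<in> t" for H
  proof -
    define B where "B = (\<lambda>A. \<i> *\<^sub>C lie H A)"
    have linB: "linear B"
      by (rule linearI) (simp_all add: B_def lie_add_right cscale_add lie_scaleR_right
          vec_eq_iff algebra_simps scaleR_conv_of_real[where 'a = complex])
    have BV: "B ` V \<subseteq> V"
      using cV Vinv[OF H] by (auto simp: B_def csubspace_def)
    have sym: "B v \<bullet> w = v \<bullet> B w" for v w
      by (simp add: B_def inner_cscale_imaginary inner_lie_antihermitian[OF anti[rule_format, OF H]]
          lie_cscale_right)
    obtain v l where v: "v \<in> V" "v \<noteq> 0" "B v = l *\<^sub>R v"
      using selfadjoint_eigenvector[OF sV V0 linB BV] sym by metis
    \<comment> \<open>The eigenvalue l of i ad H is real, and the matching eigenvalue of ad H is -i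
      l.\<close>
    define c where "c = - \<i> * of_real l"
    define V' where "V' = {A \<in> V. lie H A = c *\<^sub>C A}"
    have "lie H v = - \<i> *\<^sub>C B v"
      by (simp add: B_def cscale_cscale)
    then have "lie H v = c *\<^sub>C v"
      by (simp add: v c_def cscale_cscale flip: cscale_of_real)
    then have "v \<in> V'" using v by (simp add: V'_def)
    moreover have "csubspace V'"
      using cV by (auto simp: V'_def csubspace_def lie_add_right cscale_add lie_cscale_right
          cscale_cscale mult.commute)
    moreover have "lie K A \<in> V'" if "K \<in> t" "A \<in> V'" for K A
    proof -
      have "lie H (lie K A) = lie K (lie H A)"
        using lie_jacobi[of H K A] comm H \<open>K \<in> t\<close> by simp
      then show ?thesis
        using that Vinv by (auto simp: V'_def lie_cscale_right)
    qed
    ultimately have "P V'"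
      using v VW by (auto simp: P_def V'_def)
    then have "dim V \<le> dim V'" by (rule min)
    then have "V' = V"
      using subspace_dim_equal[of V' V] sV csubspace_imp_subspace[OF \<open>csubspace V'\<close>]
      by (auto simp: V'_def)
    then show ?thesis by (auto simp: V'_def)
  qed
  then obtain \<alpha> where \<alpha>: "\<And>H A. H \<in> t \<Longrightarrow> A \<in> V \<Longrightarrow> lie H A = \<alpha> H *\<^sub>C A"
    by metis
  obtain E where "E \<in> V" "E \<noteq> 0"
    using V0 sV subspace_0 by blast
  then show ?thesis using \<alpha> VW by blast
qed

text \<open>The inner product is real, but scaling by c has scaling by the conjugate of c as its
  adjoint, and \<open>U\<close> is closed under the latter.\<close>

lemma csubspace_orthogonal_complement:
  assumes "csubspace V" "csubspace U"
  shows "csubspace {A \<in> V. \<forall>B\<in>U. A \<bullet> B = 0}"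
proof -
  have "(c *\<^sub>C A) \<bullet> B = A \<bullet> (cnj c *\<^sub>C B)" for c and A B :: "complex^'a^'a"
    by (simp add: inner_eq_trace dagger_cscale cscale_mult_left cscale_mult_right)
  then show ?thesis
    using assms by (auto simp: csubspace_def inner_add_left)
qed

text \<open>The complex span, as opposed to the real \<open>span\<close>. Described as an
  intersection, it yields inclusions by exhibiting a complex subspace that contains the
  generators.\<close>

definition csubspace_hull :: "(complex^'n^'n) set \<Rightarrow> (complex^'n^'n) set"
  where "csubspace_hull S = \<Inter>{V. csubspace V \<and> S \<subseteq> V}"

lemma csubspace_hull_superset: "S \<subseteq> csubspace_hull S"
  and csubspace_hull_minimal: "csubspace V \<Longrightarrow> S \<subseteq> V \<Longrightarrow> csubspace_hull S \<subseteq> V"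
  by (auto simp: csubspace_hull_def)

lemma csubspace_csubspace_hull: "csubspace (csubspace_hull S)"
  unfolding csubspace_hull_def csubspace_def by blast

section \<open>Compact forms of complex algebras closed under \<open>dagger\<close>\<close>

lemma mem_compact_form: "A \<in> compact_form gC \<longleftrightarrow> A \<in> gC \<and> dagger A = - A"
  by (simp add: compact_form_def)

lemma subspace_compact_form: "csubspace gC \<Longrightarrow> subspace (compact_form gC)"
  using csubspace_imp_subspace[of gC]
  by (auto simp: compact_form_def subspace_def dagger_simps)

lemma lie_compact_form:
  "(\<And>A B. A \<in> gC \<Longrightarrow> B \<in> gC \<Longrightarrow> lie A B \<in> gC) \<Longrightarrow>
    A \<in> compact_form gC \<Longrightarrow> B \<in> compact_form gC \<Longrightarrow> lie A B \<in> compact_form gC"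
  by (simp add: mem_compact_form dagger_lie lie_uminus_left lie_uminus_right)

text \<open>The two antihermitian parts are those to which \<open>complex_extension\<close> applies
  a representation.\<close>

lemma complex_decomposition:
  assumes "csubspace gC" "\<And>A. A \<in> gC \<Longrightarrow> dagger A \<in> gC" "A \<in> gC"
  defines "X \<equiv> (1/2) *\<^sub>C (A - dagger A)" and "Y \<equiv> (1 / (2 * \<i>)) *\<^sub>C (A + dagger A)"
  shows "X \<in> compact_form gC" "Y \<in> compact_form gC" "A = X + \<i> *\<^sub>C Y"
proof -
  have "A - dagger A \<in> gC"
    using assms(1-3) by (intro subspace_diff csubspace_imp_subspace)
  then show "X \<in> compact_form gC" "Y \<in> compact_form gC"
    using assms(1-3)
    by (auto simp: X_def Y_def mem_compact_form csubspace_def dagger_simps vec_eq_iff algebra_simps divide_simps)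
  show "A = X + \<i> *\<^sub>C Y"
    by (simp add: X_def Y_def cscale_cscale vec_eq_iff field_simps)
qed

text \<open>In the form case, conjugate the defining equation entrywise. Unitarity and the symmetry
  of \<open>S\<close> turn the conjugate of \<open>S\<close> into plus or minus its inverse.\<close>

lemma dagger_classical:
  fixes gC :: "(complex^'n^'n) set"
  assumes "classical_type gC" "A \<in> gC"
  shows "dagger A \<in> gC"
proof (cases "gC = special_linear_algebra")
  case True
  then show ?thesis
    using assms(2) by (simp add: special_linear_algebra_def trace_dagger)
next
  case False
  then obtain S where S: "dagger S ** S = mat 1" "transpose S = S \<or> transpose S = - S"
    and gC: "gC = bilinear_form_algebra S"
    using assms(1) unfolding classical_type_def by blast
  have SS: "S ** dagger S = mat 1"
    using S(1) matrix_left_right_inverse by blast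
  define C where "C = transpose (dagger A)"
  have "transpose A ** S + S ** A = 0"
    using assms(2) gC by (simp add: bilinear_form_algebra_def)
  then have "transpose (dagger (transpose A ** S + S ** A)) = 0"
    by (simp add: transpose_def vec_eq_iff)
  moreover have "transpose (dagger (transpose A)) = dagger A"
    by (simp add: transpose_def vec_eq_iff)
  moreover have "transpose (dagger S) = dagger (transpose S)"
    by (simp add: transpose_def vec_eq_iff)
  moreover have "transpose (D + E) = transpose D + transpose E" for D E :: "complex^'n^'n"
    by (simp add: transpose_def vec_eq_iff)
  ultimately have "dagger A ** dagger (transpose S) + dagger (transpose S) ** C = 0"
    by (simp add: dagger_simps matrix_transpose_mul C_def)
  then have "dagger A ** dagger S + dagger S ** C = 0 \<or> - (dagger A ** dagger S + dagger S ** C) = 0"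
    using S(2) by (auto simp: dagger_uminus matrix_uminus_left matrix_uminus_right)
  then have *: "dagger A ** dagger S + dagger S ** C = 0"
    by (simp only: neg_equal_0_iff_equal disj.idem)
  \<comment> \<open>Multiplying by \<open>S\<close> on both sides converts the equation for the
    inverse form into the one for \<open>S\<close>, with \<open>dagger A\<close> in place of
    \<open>A\<close>.\<close>
  have "S ** (dagger A ** dagger S + dagger S ** C) ** S
      = S ** dagger A ** (dagger S ** S) + (S ** dagger S) ** C ** S"
    by (simp only: matrix_ring_simps)
  then have "C ** S + S ** dagger A = 0"
    unfolding * by (simp add: S SS add.commute)
  then show ?thesis
    by (simp add: gC bilinear_form_algebra_def C_def)
qed

text \<open>The orthogonal complement in \<open>gC\<close> of the complex span of \<open>t\<close>
  and the root spaces is invariant under ad t. If nonzero, it contains a joint eigenvector; this one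
  lies in the span as well and is orthogonal to itself. The conclusion is phrased as an inclusion so
  that it can serve for induction.\<close>

lemma root_space_decomposition:
  assumes gC: "csubspace gC" "\<And>A B. A \<in> gC \<Longrightarrow> B \<in> gC \<Longrightarrow> lie A B \<in> gC"
      "\<And>A. A \<in> gC \<Longrightarrow> dagger A \<in> gC"
    and t: "cartan_subalgebra (compact_form gC) t"
    and V: "csubspace V" "t \<subseteq> V" "\<And>\<alpha>. \<alpha> \<in> roots gC t \<Longrightarrow> root_space gC t \<alpha> \<subseteq> V"
  shows "gC \<subseteq> V"
proof -
  define S where "S = t \<union> (\<Union>\<alpha>\<in>roots gC t. root_space gC t \<alpha>)"
  define V\<^sub>0 where "V\<^sub>0 = csubspace_hull S"
  have cV: "csubspace V\<^sub>0" and SV: "S \<subseteq> V\<^sub>0"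
    by (simp_all add: V\<^sub>0_def csubspace_csubspace_hull csubspace_hull_superset)
  have tg: "t \<subseteq> compact_form gC" and comm: "\<And>H K. H \<in> t \<Longrightarrow> K \<in> t \<Longrightarrow> lie H K = 0"
    and max: "\<And>A. A \<in> compact_form gC \<Longrightarrow> (\<And>H. H \<in> t \<Longrightarrow> lie A H = 0) \<Longrightarrow> A \<in> t"
    using t by (auto simp: cartan_subalgebra_def)
  have tgC: "t \<subseteq> gC" and anti: "\<And>H. H \<in> t \<Longrightarrow> dagger H = - H"
    using tg by (auto simp: mem_compact_form)
  have VgC: "V\<^sub>0 \<subseteq> gC"
    unfolding V\<^sub>0_def by (rule csubspace_hull_minimal) (use tgC gC in \<open>auto simp: S_def root_space_def\<close>)
  \<comment> \<open>The elements of the span whose brackets with \<open>t\<close> remain in it form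
    a complex subspace that contains the generators.\<close>
  have "V\<^sub>0 \<subseteq> {A \<in> V\<^sub>0. \<forall>H\<in>t. lie H A \<in> V\<^sub>0}" (is "_ \<subseteq> ?U")
    unfolding V\<^sub>0_def
  proof (rule csubspace_hull_minimal, unfold V\<^sub>0_def[symmetric])
    show "csubspace ?U"
      using cV by (auto simp: csubspace_def lie_add_right lie_cscale_right)
    show "S \<subseteq> ?U"
    proof
      fix A assume A: "A \<in> S"
      then have "lie H A \<in> V\<^sub>0" if "H \<in> t" for H
        using comm[OF that, of A] that cV SV by (auto simp: S_def root_space_def csubspace_def)
      then show "A \<in> ?U" using A SV by auto
    qed
  qed
  then have Vinv: "\<And>H A. H \<in> t \<Longrightarrow> A \<in> V\<^sub>0 \<Longrightarrow> lie H A \<in> V\<^sub>0" by blast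
  define W where "W = {A \<in> gC. \<forall>B\<in>V\<^sub>0. A \<bullet> B = 0}"
  have gCinv: "\<And>H A. H \<in> t \<Longrightarrow> A \<in> gC \<Longrightarrow> lie H A \<in> gC"
    using tgC gC(2) by blast
  have cW: "csubspace W"
    unfolding W_def by (intro csubspace_orthogonal_complement gC(1) cV)
  have Winv: "\<And>H A. H \<in> t \<Longrightarrow> A \<in> W \<Longrightarrow> lie H A \<in> W"
    by (simp add: W_def inner_lie_antihermitian gCinv Vinv anti)
  have "W = {0}"
  proof (rule ccontr)
    assume "W \<noteq> {0}"
    from common_eigenvector[OF cW this, of t] Winv anti comm
    obtain E \<alpha> where E: "E \<in> W" "E \<noteq> 0" "\<And>H. H \<in> t \<Longrightarrow> lie H E = \<alpha> H *\<^sub>C E"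
      by blast
    have EgC: "E \<in> gC" using E(1) by (simp add: W_def)
    have "E \<in> V\<^sub>0"
    proof (cases "\<exists>H\<in>t. \<alpha> H \<noteq> 0")
      case True
      \<comment> \<open>The weight is cut off outside \<open>t\<close>, in accordance with the
        convention in \<open>roots\<close>.\<close>
      define \<beta> where "\<beta> = (\<lambda>H. if H \<in> t then \<alpha> H else 0)"
      have "E \<in> root_space gC t \<beta>"
        using E EgC by (simp add: root_space_def \<beta>_def)
      moreover have "\<beta> \<in> roots gC t"
        using True E(2) calculation by (auto simp: roots_def \<beta>_def)
      ultimately show ?thesis using SV by (auto simp: S_def)
    next
      case False
      \<comment> \<open>At weight zero both E and its adjoint commute with \<open>t\<close>. So do
        the antihermitian parts of E, and maximality puts them into \<open>t\<close>.\<close>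
      then have E0: "lie E H = 0" "lie (dagger E) H = 0" if "H \<in> t" for H
        using E(3)[OF that] dagger_lie[of H E] that anti[OF that]
        by (auto simp: lie_commute[of _ H] lie_uminus_left)
      define X Y where "X = (1/2) *\<^sub>C (E - dagger E)" and "Y = (1 / (2 * \<i>)) *\<^sub>C (E + dagger E)"
      have XY: "X \<in> compact_form gC" "Y \<in> compact_form gC" "E = X + \<i> *\<^sub>C Y"
        unfolding X_def Y_def by (rule complex_decomposition[OF gC(1,3) EgC]; assumption)+
      have "X \<in> t" "Y \<in> t"
        by (auto intro!: max XY(1,2))
          (simp_all add: X_def Y_def lie_cscale_left lie_diff_left lie_add_left E0)
      then have "X \<in> V\<^sub>0" "\<i> *\<^sub>C Y \<in> V\<^sub>0"
        using SV cV by (auto simp: S_def csubspace_def)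
      then show ?thesis
        using XY(3) cV by (simp add: csubspace_def)
    qed
    then have "E \<bullet> E = 0" using E(1) by (simp add: W_def)
    then show False using E(2) by simp
  qed
  have "A \<in> V\<^sub>0" if A: "A \<in> gC" for A
  proof -
    obtain y z where yz: "y \<in> span V\<^sub>0" "\<And>w. w \<in> span V\<^sub>0 \<Longrightarrow> orthogonal z w" "A = y + z"
      using orthogonal_subspace_decomp_exists by blast
    have y: "y \<in> V\<^sub>0"
      using yz(1) cV csubspace_imp_subspace span_eq_iff by blast
    have "z = A - y" using yz(3) by simp
    then have "z \<in> gC"
      using A y VgC csubspace_imp_subspace[OF gC(1)] by (auto intro: subspace_diff)
    then have "z \<in> W"
      using yz(2) by (auto simp: W_def orthogonal_def intro: span_base)
    then show ?thesis using \<open>W = {0}\<close> y yz(3) by simp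
  qed
  moreover have "V\<^sub>0 \<subseteq> V"
    unfolding V\<^sub>0_def using V by (intro csubspace_hull_minimal) (auto simp: S_def)
  ultimately show ?thesis by blast
qed

section \<open>Root data, the map \<open>J\<close> and the central element \<rho>\<close>

locale hermitian_symmetric_data =
  fixes gC g t :: "(complex^'n^'n) set"
    and Pos :: "(complex^'n^'n \<Rightarrow> complex) set"
    and \<phi> :: "complex^'n^'n \<Rightarrow> complex"
    and \<rho> :: "complex^'n^'n"
    and J :: "complex^'n^'n \<Rightarrow> complex^'n^'n"
  assumes simple: "complex_simple_lie_algebra gC" and classical: "classical_type gC"
    and g_def: "g = compact_form gC"
    and cartan: "cartan_subalgebra g t"
    and pos: "positive_system (roots gC t) Pos"
    and noncompact: "noncompact_simple_root Pos \<phi>"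
    and \<rho>_center: "\<rho> \<in> lie_center (isotropy_algebra gC t Pos \<phi>)" and \<phi>_\<rho>: "\<phi> \<rho> = \<i>"
    and is_J: "is_J gC t Pos J"
begin

lemma csubspace_gC: "csubspace gC"
  and lie_gC: "A \<in> gC \<Longrightarrow> B \<in> gC \<Longrightarrow> lie A B \<in> gC"
  using simple by (auto simp: complex_simple_lie_algebra_def)

lemma dagger_gC: "A \<in> gC \<Longrightarrow> dagger A \<in> gC"
  using classical by (rule dagger_classical)

lemma subspace_g: "subspace g"
  by (simp add: g_def subspace_compact_form csubspace_gC)

lemma lie_g: "A \<in> g \<Longrightarrow> B \<in> g \<Longrightarrow> lie A B \<in> g"
  unfolding g_def using lie_compact_form lie_gC by blast

lemma g_antihermitian: "A \<in> g \<Longrightarrow> dagger A = - A"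
  and g_subset_gC: "g \<subseteq> gC"
  by (auto simp: g_def mem_compact_form)

lemma t_subset_g: "t \<subseteq> g" and t_commute: "H \<in> t \<Longrightarrow> K \<in> t \<Longrightarrow> lie H K = 0"
  and t_maximal: "A \<in> g \<Longrightarrow> (\<And>H. H \<in> t \<Longrightarrow> lie A H = 0) \<Longrightarrow> A \<in> t"
  and subspace_t: "subspace t"
  using cartan by (auto simp: cartan_subalgebra_def)

text \<open>The induction principle by which complex linear identities on \<open>gC\<close> are
  verified on \<open>t\<close> and on root vectors alone.\<close>

lemma gC_induct:
  assumes "csubspace V" "t \<subseteq> V"
    and "\<And>\<alpha>. \<alpha> \<in> Pos \<Longrightarrow> root_space gC t \<alpha> \<subseteq> V \<and> root_space gC t (- \<alpha>) \<subseteq> V"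
  shows "gC \<subseteq> V"
proof (rule root_space_decomposition[OF csubspace_gC lie_gC dagger_gC cartan[unfolded g_def] assms(1,2)])
  fix \<alpha> assume "\<alpha> \<in> roots gC t"
  then have "\<alpha> \<in> Pos \<or> - \<alpha> \<in> Pos"
    using pos by (auto simp: positive_system_def)
  then show "root_space gC t \<alpha> \<subseteq> V"
    using assms(3)[of \<alpha>] assms(3)[of "- \<alpha>"] by (auto simp: fun_Compl_def)
qed auto

text \<open>By skewness of ad H the inner product of [H, E] with E vanishes, and it equals Re
  (\<alpha> H) times the squared norm of E.\<close>

lemma root_imaginary:
  assumes "\<alpha> \<in> roots gC t"
  shows "cnj (\<alpha> H) = - \<alpha> H"
proof (cases "H \<in> t")
  case True
  obtain E where E: "E \<in> root_space gC t \<alpha>" "E \<noteq> 0"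
    using assms by (auto simp: roots_def)
  have "(\<alpha> H *\<^sub>C E) \<bullet> E = 0"
    using inner_lie_antihermitian[of H E E] E True g_antihermitian t_subset_g
    by (auto simp: root_space_def inner_commute)
  moreover have "(\<alpha> H *\<^sub>C E) \<bullet> E = Re (\<alpha> H) * (E \<bullet> E)"
  proof -
    have "Im (trace (dagger E ** E)) = 0"
      using trace_dagger[of "dagger E ** E"] by (simp add: dagger_mult complex_eq_iff)
    then show ?thesis
      by (simp add: inner_eq_trace dagger_cscale cscale_mult_left trace_cscale)
  qed
  ultimately show ?thesis
    using E(2) by (simp add: complex_eq_iff)
qed (use assms in \<open>auto simp: roots_def\<close>)

text \<open>Taking adjoints commutes with ad H for antihermitian H and conjugates the eigenvalue,
  which is imaginary.\<close>

lemma dagger_root_space: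
  assumes "\<alpha> \<in> roots gC t" "E \<in> root_space gC t \<alpha>"
  shows "dagger E \<in> root_space gC t (- \<alpha>)"
proof -
  have "lie H (dagger E) = - \<alpha> H *\<^sub>C dagger E" if "H \<in> t" for H
    using assms that dagger_lie[of H E] g_antihermitian[of H] t_subset_g root_imaginary[OF assms(1), of H]
    by (auto simp: root_space_def lie_uminus_left dagger_cscale)
  then show ?thesis
    using assms(2) by (auto simp: root_space_def dagger_gC)
qed

lemma Pos_subset_roots: "Pos \<subseteq> roots gC t"
  using pos by (simp add: positive_system_def)

lemma uminus_roots:
  assumes "\<alpha> \<in> roots gC t" shows "- \<alpha> \<in> roots gC t"
proof -
  obtain E where "E \<in> root_space gC t \<alpha>" "E \<noteq> 0"
    using assms by (auto simp: roots_def)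
  then have "dagger E \<in> root_space gC t (- \<alpha>)" "dagger E \<noteq> 0"
    using dagger_root_space[OF assms] dagger_dagger[of E] by fastforce+
  then show ?thesis using assms by (auto simp: roots_def)
qed

lemma J_gC: "A \<in> gC \<Longrightarrow> J A \<in> gC"
  and J_add: "A \<in> gC \<Longrightarrow> B \<in> gC \<Longrightarrow> J (A + B) = J A + J B"
  and J_cscale: "A \<in> gC \<Longrightarrow> J (c *\<^sub>C A) = c *\<^sub>C J A"
  and J_t: "H \<in> t \<Longrightarrow> J H = 0"
  and J_pos: "\<alpha> \<in> Pos \<Longrightarrow> E \<in> root_space gC t \<alpha> \<Longrightarrow> J E = \<i> *\<^sub>C E"
  and J_neg: "\<alpha> \<in> Pos \<Longrightarrow> E \<in> root_space gC t (- \<alpha>) \<Longrightarrow> J E = - \<i> *\<^sub>C E"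
  using is_J by (auto simp: is_J_def)

lemma J_0 [simp]: "J 0 = 0"
  using J_t subspace_t subspace_0 by blast

lemma J_uminus: "A \<in> gC \<Longrightarrow> J (- A) = - J A"
  using J_cscale[of A "-1"] by (simp add: cscale_uminus_left)

text \<open>Adjoints exchange the root spaces of \<alpha> and -\<alpha>, while conjugation exchanges
  i and -i. Hence \<open>J\<close> preserves the compact form, as recorded in
  \<open>J_g\<close>.\<close>

lemma J_dagger: "A \<in> gC \<Longrightarrow> J (dagger A) = dagger (J A)"
proof -
  have "gC \<subseteq> {A \<in> gC. J (dagger A) = dagger (J A)}"
  proof (rule gC_induct)
    show "csubspace {A \<in> gC. J (dagger A) = dagger (J A)}"
      using csubspace_gC by (auto simp: csubspace_def dagger_simps J_add J_cscale dagger_gC)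
    show "t \<subseteq> {A \<in> gC. J (dagger A) = dagger (J A)}"
    proof
      fix H assume H: "H \<in> t"
      then have "H \<in> g" "- H \<in> t" using t_subset_g subspace_t subspace_neg by auto
      then show "H \<in> {A \<in> gC. J (dagger A) = dagger (J A)}"
        using H g_subset_gC by (auto simp: g_antihermitian J_t)
    qed
    fix \<alpha> assume \<alpha>: "\<alpha> \<in> Pos"
    then have \<alpha>r: "\<alpha> \<in> roots gC t" using Pos_subset_roots by blast
    show "root_space gC t \<alpha> \<subseteq> {A \<in> gC. J (dagger A) = dagger (J A)} \<and>
        root_space gC t (- \<alpha>) \<subseteq> {A \<in> gC. J (dagger A) = dagger (J A)}"
      using J_pos[OF \<alpha>] J_neg[OF \<alpha>] dagger_root_space[OF \<alpha>r] dagger_root_space[OF uminus_roots[OF \<alpha>r]]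
      by (auto simp: dagger_cscale) (auto simp: root_space_def)
  qed
  then show "A \<in> gC \<Longrightarrow> J (dagger A) = dagger (J A)" by blast
qed

lemma J_g: "A \<in> g \<Longrightarrow> J A \<in> g"
  using J_dagger[of A] J_uminus[of A] by (simp add: g_def mem_compact_form J_gC)

lemma isotropy_subset_g: "isotropy_algebra gC t Pos \<phi> \<subseteq> g"
  unfolding isotropy_algebra_def g_def[symmetric]
  by (rule span_minimal[OF _ subspace_g]) (use t_subset_g in auto)

text \<open>The isotropy algebra contains \<open>t\<close>, so its central element \<rho> commutes
  with \<open>t\<close>, which is maximal abelian.\<close>

lemma \<rho>_t: "\<rho> \<in> t"
proof (rule t_maximal)
  show "\<rho> \<in> g" using \<rho>_center isotropy_subset_g by (auto simp: lie_center_def)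
  fix H assume "H \<in> t"
  then have "H \<in> isotropy_algebra gC t Pos \<phi>"
    by (auto simp: isotropy_algebra_def intro: span_base)
  then show "lie \<rho> H = 0" using \<rho>_center by (simp add: lie_center_def)
qed

text \<open>For a root vector E the matrix E - dagger E lies in the isotropy algebra, so \<rho>
  commutes with it; that bracket is \<alpha> \<rho> times E + dagger E.\<close>

lemma compact_root_\<rho>:
  assumes "\<alpha> \<in> compact_positive_roots Pos \<phi>"
  shows "\<alpha> \<rho> = 0"
proof (rule ccontr)
  assume nz: "\<alpha> \<rho> \<noteq> 0"
  have \<alpha>: "\<alpha> \<in> roots gC t"
    using assms Pos_subset_roots by (auto simp: compact_positive_roots_def)
  obtain E where E: "E \<in> root_space gC t \<alpha>" "E \<noteq> 0"
    using \<alpha> by (auto simp: roots_def)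
  have EgC: "E \<in> gC" using E by (simp add: root_space_def)
  have dE: "dagger E \<in> root_space gC t (- \<alpha>)" by (rule dagger_root_space[OF \<alpha> E(1)])
  have mdE: "- dagger E \<in> root_space gC t (- \<alpha>)"
    using dE csubspace_uminus[OF csubspace_gC]
    by (auto simp: root_space_def lie_uminus_right cscale_uminus)
  have "E + - dagger E \<in> gC"
    using EgC mdE csubspace_gC by (auto simp: root_space_def csubspace_def)
  then have "E + - dagger E \<in> compact_form gC"
    by (simp add: mem_compact_form dagger_simps)
  moreover have "E + - dagger E \<in> {E + F |E F. E \<in> root_space gC t \<alpha> \<and> F \<in> root_space gC t (- \<alpha>)}"
    using E(1) mdE by (intro CollectI exI[of _ E] exI[of _ "- dagger E"] conjI refl)
  ultimately have "E + - dagger E \<in> (\<Union>\<alpha>\<in>compact_positive_roots Pos \<phi>.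
      {E + F |E F. E \<in> root_space gC t \<alpha> \<and> F \<in> root_space gC t (- \<alpha>)} \<inter> compact_form gC)"
    using assms by blast
  then have "E + - dagger E \<in> isotropy_algebra gC t Pos \<phi>"
    unfolding isotropy_algebra_def by (intro span_base UnI2)
  then have "lie \<rho> (E + - dagger E) = 0"
    using \<rho>_center by (simp add: lie_center_def)
  moreover have "lie \<rho> E = \<alpha> \<rho> *\<^sub>C E" "lie \<rho> (dagger E) = - (\<alpha> \<rho> *\<^sub>C dagger E)"
    using E(1) dE \<rho>_t by (simp_all add: root_space_def cscale_uminus_left)
  ultimately have "\<alpha> \<rho> *\<^sub>C (E + dagger E) = 0"
    by (simp add: lie_diff_right cscale_add)
  \<comment> \<open>An antihermitian E would lie in the root spaces of both signs, so that \<alpha>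
    \<rho> would equal its negative.\<close>
  then have "E = - dagger E"
    using nz by (simp add: eq_neg_iff_add_eq_0)
  then have "E \<in> root_space gC t (- \<alpha>)" using mdE by simp
  then have "\<alpha> \<rho> *\<^sub>C E = - \<alpha> \<rho> *\<^sub>C E"
    using E(1) \<rho>_t unfolding root_space_def by force
  then have "(2 * \<alpha> \<rho>) *\<^sub>C E = 0"
    by (simp add: vec_eq_iff)
  then show False using nz E(2) by simp
qed

text \<open>For infinitely many simple roots the sum in \<^const>\<open>appears_with\<close> would be the junk value
  \<open>0\<close>, which is not a root; so finiteness comes for free.\<close>

lemma pos_root_\<rho>:
  assumes "\<alpha> \<in> Pos"
  shows "\<alpha> \<rho> = 0 \<or> \<alpha> \<rho> = \<i>"
proof -
  let ?\<Sigma> = "simple_roots Pos"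
  have \<phi>: "\<phi> \<in> ?\<Sigma>" and nc: "\<And>\<alpha>. \<alpha> \<in> Pos \<Longrightarrow> appears_with Pos \<phi> \<alpha> 0 \<or> appears_with Pos \<phi> \<alpha> 1"
    using noncompact by (auto simp: noncompact_simple_root_def)
  have fin: "finite ?\<Sigma>"
  proof (rule ccontr)
    assume "infinite ?\<Sigma>"
    then have "\<alpha> = (\<lambda>H. 0)"
      using nc[OF assms] by (auto simp: appears_with_def)
    then show False using assms Pos_subset_roots by (auto simp: roots_def)
  qed
  have \<sigma>0: "\<sigma> \<rho> = 0" if "\<sigma> \<in> ?\<Sigma>" "\<sigma> \<noteq> \<phi>" for \<sigma>
  proof (rule compact_root_\<rho>)
    \<comment> \<open>A simple root is its own expansion, with indicator coefficients; the one at
      \<phi> is zero.\<close>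
    have "\<sigma> = (\<lambda>H. \<Sum>\<tau>\<in>?\<Sigma>. of_nat (if \<tau> = \<sigma> then 1 else 0) * \<tau> H)"
    proof
      fix H
      have "(\<Sum>\<tau>\<in>?\<Sigma>. of_nat (if \<tau> = \<sigma> then 1 else 0) * \<tau> H) = (\<Sum>\<tau>\<in>?\<Sigma>. if \<tau> = \<sigma> then \<tau> H else 0)"
        by (rule sum.cong) auto
      then show "\<sigma> H = (\<Sum>\<tau>\<in>?\<Sigma>. of_nat (if \<tau> = \<sigma> then 1 else 0) * \<tau> H)"
        using fin that(1) by (simp add: sum.delta)
    qed
    then have "appears_with Pos \<phi> \<sigma> 0"
      unfolding appears_with_def using that(2) by (intro exI[of _ "\<lambda>\<tau>. if \<tau> = \<sigma> then 1 else 0"]) auto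
    then show "\<sigma> \<in> compact_positive_roots Pos \<phi>"
      using that by (auto simp: compact_positive_roots_def simple_roots_def)
  qed
  obtain c :: "_ \<Rightarrow> nat" where c: "\<alpha> = (\<lambda>H. \<Sum>\<sigma>\<in>?\<Sigma>. of_nat (c \<sigma>) * \<sigma> H)" "c \<phi> = 0 \<or> c \<phi> = 1"
    using nc[OF assms] unfolding appears_with_def by blast
  have "\<alpha> \<rho> = (\<Sum>\<sigma>\<in>?\<Sigma>. of_nat (c \<sigma>) * \<sigma> \<rho>)"
    by (subst c(1)) simp
  also have "\<dots> = (\<Sum>\<sigma>\<in>?\<Sigma>. if \<sigma> = \<phi> then of_nat (c \<phi>) * \<i> else 0)"
    by (rule sum.cong) (auto simp: \<sigma>0 \<phi>_\<rho>)
  also have "\<dots> = of_nat (c \<phi>) * \<i>"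
    using fin \<phi> by simp
  finally show ?thesis using c(2) by auto
qed

text \<open>On root vectors ad \<rho> is 0 or has the eigenvalue of \<open>J\<close>, by
  \<open>pos_root_\<rho>\<close>. Stating both identities after one application of ad \<rho> removes
  \<open>t\<close> and the compact root spaces, where ad \<rho> vanishes.\<close>

lemma J_eq_ad_\<rho>:
  assumes "A \<in> gC"
  shows "J (lie \<rho> A) = lie \<rho> (lie \<rho> A)" and "lie \<rho> (lie \<rho> (lie \<rho> A)) = - lie \<rho> A"
proof -
  let ?V = "{A \<in> gC. J (lie \<rho> A) = lie \<rho> (lie \<rho> A) \<and> lie \<rho> (lie \<rho> (lie \<rho> A)) = - lie \<rho> A}"
  have \<rho>gC: "\<rho> \<in> gC" using \<rho>_t t_subset_g g_subset_gC by blast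
  have "gC \<subseteq> ?V"
  proof (rule gC_induct)
    have gC: "0 \<in> gC" "\<And>A B. A \<in> gC \<Longrightarrow> B \<in> gC \<Longrightarrow> A + B \<in> gC" "\<And>c A. A \<in> gC \<Longrightarrow> c *\<^sub>C A \<in> gC"
      using csubspace_gC by (auto simp: csubspace_def)
    show "csubspace ?V"
      unfolding csubspace_def
      by (auto simp: gC lie_add_right lie_cscale_right J_add J_cscale lie_gC \<rho>gC cscale_uminus)
    show "t \<subseteq> ?V"
    proof
      fix H assume "H \<in> t"
      then show "H \<in> ?V"
        using t_subset_g g_subset_gC t_commute[OF \<rho>_t, of H] by auto
    qed
    fix \<alpha> assume \<alpha>: "\<alpha> \<in> Pos"
    have "E \<in> ?V" if "E \<in> root_space gC t \<alpha> \<or> E \<in> root_space gC t (- \<alpha>)" for E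
      using that
    proof
      assume E: "E \<in> root_space gC t \<alpha>"
      then have "lie \<rho> E = \<alpha> \<rho> *\<^sub>C E" "E \<in> gC"
        using \<rho>_t by (auto simp: root_space_def)
      then show ?thesis
        using pos_root_\<rho>[OF \<alpha>] J_pos[OF \<alpha> E]
        by (auto simp: lie_cscale_right J_cscale cscale_cscale cscale_uminus_left)
    next
      assume E: "E \<in> root_space gC t (- \<alpha>)"
      then have "lie \<rho> E = - \<alpha> \<rho> *\<^sub>C E" "E \<in> gC"
        using \<rho>_t by (auto simp: root_space_def)
      then show ?thesis
        using pos_root_\<rho>[OF \<alpha>] J_neg[OF \<alpha> E] J_cscale[of E "- \<i>"]
        by (auto simp: lie_cscale_right J_cscale cscale_cscale cscale_uminus_left lie_uminus_right
            cscale_uminus J_uminus)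
    qed
    then show "root_space gC t \<alpha> \<subseteq> ?V \<and> root_space gC t (- \<alpha>) \<subseteq> ?V" by blast
  qed
  then show "J (lie \<rho> A) = lie \<rho> (lie \<rho> A)" and "lie \<rho> (lie \<rho> (lie \<rho> A)) = - lie \<rho> A"
    using assms by auto
qed

end

section \<open>The group and the adjoint orbit\<close>

text \<open>Identities between exponentials are obtained below from a curve with zero derivative, by
  comparing s = 1 with s = 0.\<close>

lemma zero_vector_derivative_const:
  fixes F :: "real \<Rightarrow> 'a::real_normed_vector"
  assumes "\<And>s. (F has_vector_derivative 0) (at s)"
  shows "F s = F 0"
  using has_vector_derivative_zero_constant[of UNIV F] assms by (metis UNIV_I convex_UNIV)

text \<open>Serves for \<open>transpose\<close> with a bilinear form \<open>S\<close> and for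
  \<open>dagger\<close> with the identity. Along exp (s A) the derivative of the transformed
  \<open>S\<close> contains the infinitesimal condition as a factor.\<close>

lemma mexp_antihomomorphism_invariant:
  fixes A S :: "complex^'n^'n"
  assumes P: "bounded_linear P" "\<And>X Y. P (X ** Y) = P Y ** P X" "P (mat 1) = mat 1"
    and A: "P A ** S + S ** A = 0"
  shows "P (mexp A) ** S ** mexp A = S"
proof -
  let ?f = "\<lambda>s. mexp (s *\<^sub>R A)"
  define F where "F = (\<lambda>s. P (?f s) ** S ** ?f s)"
  have "(F has_vector_derivative 0) (at s)" for s
  proof -
    have f: "(?f has_vector_derivative A ** ?f s) (at s)"
      by (rule mexp_has_vector_derivative)
    have Pf: "((\<lambda>s. P (?f s)) has_vector_derivative P (?f s) ** P A) (at s)"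
      using bounded_linear.has_vector_derivative[OF P(1) f] by (simp add: P(2))
    have "((\<lambda>s. P (?f s) ** S) has_vector_derivative P (?f s) ** P A ** S) (at s)"
      by (rule bounded_linear.has_vector_derivative[OF matrix_mult.bounded_linear_left Pf])
    from matrix_mult.has_vector_derivative[OF this f]
    have "(F has_vector_derivative P (?f s) ** S ** (A ** ?f s) + P (?f s) ** P A ** S ** ?f s) (at s)"
      by (simp add: F_def)
    moreover have "P (?f s) ** S ** (A ** ?f s) + P (?f s) ** P A ** S ** ?f s
        = P (?f s) ** (P A ** S + S ** A) ** ?f s"
      by (simp add: matrix_ring_simps)
    ultimately show ?thesis by (simp add: A)
  qed
  from zero_vector_derivative_const[OF this, of 1] show ?thesis
    by (simp add: F_def P(3))
qed

lemma mexp_uminus_inverse: "mexp (- A) ** mexp A = mat 1" "mexp A ** mexp (- A) = mat 1"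
proof -
  define F where "F = (\<lambda>s. mexp (s *\<^sub>R - A) ** mexp (s *\<^sub>R A))"
  have "(F has_vector_derivative 0) (at s)" for s
  proof -
    have "(F has_vector_derivative mexp (s *\<^sub>R - A) ** (A ** mexp (s *\<^sub>R A)) +
        - A ** mexp (s *\<^sub>R - A) ** mexp (s *\<^sub>R A)) (at s)"
      unfolding F_def by (intro matrix_mult.has_vector_derivative mexp_has_vector_derivative)
    moreover have "- A ** mexp (s *\<^sub>R - A) = - (mexp (s *\<^sub>R - A) ** A)"
      unfolding mexp_commute by (simp add: matrix_uminus_right)
    ultimately show ?thesis by (simp add: matrix_uminus_left matrix_mul_assoc)
  qed
  from zero_vector_derivative_const[OF this, of 1] show "mexp (- A) ** mexp A = mat 1"
    by (simp add: F_def)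
  then show "mexp A ** mexp (- A) = mat 1"
    using matrix_left_right_inverse by blast
qed

text \<open>At s = 0 this gives the velocities of the orbit curves; at general s it is the
  differential equation that \<open>representation_mexp\<close> compares with its image under a
  representation.\<close>

lemma mexp_conjugation_has_vector_derivative:
  "((\<lambda>s. mexp (s *\<^sub>R A) ** X ** mexp (s *\<^sub>R - A)) has_vector_derivative
     lie A (mexp (s *\<^sub>R A) ** X ** mexp (s *\<^sub>R - A))) (at s)"
proof -
  have "((\<lambda>s. mexp (s *\<^sub>R A) ** X) has_vector_derivative A ** mexp (s *\<^sub>R A) ** X) (at s)"
    by (rule bounded_linear.has_vector_derivative[OF matrix_mult.bounded_linear_left
          mexp_has_vector_derivative])
  from matrix_mult.has_vector_derivative[OF this mexp_has_vector_derivative[of "- A"]]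
  show ?thesis
    unfolding mexp_commute[of "- A"] by (simp add: lie_def matrix_ring_simps)
qed

text \<open>The trace is invariant under conjugation, and in the other case the exponential
  preserves the form \<open>S\<close>.\<close>

lemma mexp_conjugate_classical:
  fixes gC :: "(complex^'n^'n) set"
  assumes "classical_type gC" "A \<in> gC" "B \<in> gC"
  shows "mexp A ** B ** mexp (- A) \<in> gC"
proof (cases "gC = special_linear_algebra")
  case True
  have "trace (mexp A ** B ** mexp (- A)) = trace (mexp (- A) ** mexp A ** B)"
    by (metis trace_mul_sym matrix_mul_assoc)
  then show ?thesis
    using True assms(3) by (simp add: special_linear_algebra_def mexp_uminus_inverse)
next
  case False
  then obtain S where gC: "gC = bilinear_form_algebra S"
    using assms(1) unfolding classical_type_def by blast
  let ?u = "mexp A" and ?v = "mexp (- A)"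
  have A: "transpose A ** S + S ** A = 0" and B: "transpose B ** S + S ** B = 0"
    using assms(2,3) by (auto simp: gC bilinear_form_algebra_def)
  have inv: "transpose ?u ** S ** ?u = S"
    using mexp_antihomomorphism_invariant[OF bounded_linear_transpose matrix_transpose_mul transpose_mat A] .
  have one: "transpose ?v ** transpose ?u = mat 1"
    by (simp flip: matrix_transpose_mul add: mexp_uminus_inverse)
  \<comment> \<open>Identity factors are inserted so that both summands contain transpose u S u, to
    which \<open>inv\<close> applies.\<close>
  have "transpose (?u ** B ** ?v) ** S + S ** (?u ** B ** ?v)
     = transpose ?v ** transpose B ** transpose ?u ** S ** (?u ** ?v)
      + (transpose ?v ** transpose ?u) ** S ** ?u ** B ** ?v"
    by (simp add: one mexp_uminus_inverse matrix_transpose_mul matrix_ring_simps)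
  also have "\<dots> = transpose ?v ** (transpose B ** (transpose ?u ** S ** ?u)
      + (transpose ?u ** S ** ?u) ** B) ** ?v"
    by (simp add: matrix_ring_simps)
  also have "\<dots> = 0"
    by (simp add: inv B)
  finally show ?thesis by (simp add: gC bilinear_form_algebra_def)
qed

lemma unitary_matrix_inv:
  fixes u :: "complex^'n^'n"
  assumes "dagger u ** u = mat 1"
  shows "matrix_inv u = dagger u"
proof -
  have "u ** dagger u = mat 1"
    using assms matrix_left_right_inverse by blast
  then have "u ** matrix_inv u = mat 1 \<and> matrix_inv u ** u = mat 1"
    unfolding matrix_inv_def using assms by (metis (mono_tags, lifting) someI_ex)
  then show ?thesis
    by (metis assms matrix_mul_assoc matrix_mul_lid matrix_mul_rid)
qed

text \<open>The derivative within a thin set is a choice among several linear maps. A curve inside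
  \<open>S\<close> with velocity \<open>v\<close> pins down its value at \<open>v\<close>.\<close>

lemma differential_curve:
  assumes F: "F differentiable (at x within S)" and v: "v \<in> T x"
    and c: "\<And>s. c s \<in> S" "c 0 = x" "(c has_vector_derivative v) (at 0)"
    and w: "((\<lambda>s. F (c s)) has_vector_derivative w) (at 0)"
  shows "differential S T F x v = w"
proof -
  have "(F has_derivative frechet_derivative F (at x within S)) (at (c 0) within range c)"
    using F c(1,2) by (auto simp: frechet_derivative_works intro: has_derivative_subset)
  from vector_derivative_diff_chain_within[OF c(3) this]
  have "((\<lambda>s. F (c s)) has_vector_derivative frechet_derivative F (at x within S) v) (at 0)"
    by (simp add: o_def)
  from vector_derivative_unique_at[OF this w] show ?thesis
    by (simp add: differential_def v)
qed

lemma bounded_linear_differential_curve: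
  assumes "bounded_linear L" "\<And>y. y \<in> S \<Longrightarrow> F y = L y" "v \<in> T x"
    and c: "\<And>s. c s \<in> S" "c 0 = x" "(c has_vector_derivative v) (at 0)"
  shows "differential S T F x v = L v"
proof (rule differential_curve[where c = c])
  have "x \<in> S" using c(1)[of 0] c(2) by simp
  then show "F differentiable (at x within S)"
    by (rule differentiable_transform_within[OF bounded_linear_imp_differentiable[OF assms(1)] zero_less_one])
      (simp add: assms(2))
  show "((\<lambda>s. F (c s)) has_vector_derivative L v) (at 0)"
    using bounded_linear.has_vector_derivative[OF assms(1) c(3)] by (simp add: assms(2) c(1))
qed (use assms in auto)

lemma C_k_const: "C_k k (\<lambda>x. c)"
  by (induction k arbitrary: c) (auto simp: frechet_derivative_const)

text \<open>Admits the moment components as test functions in \<open>poisson_map\<close>.\<close>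

lemma bounded_linear_smooth_fun:
  assumes "bounded_linear f"
  shows "smooth_fun S f"
proof -
  have f: "(f has_derivative f) (at x)" for x
    using assms by (rule bounded_linear_imp_has_derivative)
  have "C_k k f" for k
  proof (cases k)
    case 0
    then show ?thesis using assms by (simp add: linear_continuous_on)
  next
    case (Suc l)
    then show ?thesis
      using f frechet_derivative_at[OF f] C_k_const by (auto simp: differentiable_def)
  qed
  then show ?thesis by (auto simp: smooth_fun_def)
qed

text \<open>Covectors and representations are linear on a subspace only; extending them to the
  ambient space makes adjoints and derivatives available.\<close>

lemma linear_extension:
  fixes f :: "'a::euclidean_space \<Rightarrow> 'b::euclidean_space"
  assumes S: "subspace S"
    and f: "\<And>x y. x \<in> S \<Longrightarrow> y \<in> S \<Longrightarrow> f (x + y) = f x + f y" "\<And>c x. x \<in> S \<Longrightarrow> f (c *\<^sub>R x) = c *\<^sub>R f x"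
  obtains h where "linear h" "\<And>x. x \<in> S \<Longrightarrow> h x = f x"
proof -
  obtain B where B: "B \<subseteq> S" "independent B" "S \<subseteq> span B"
    using basis_exists by metis
  obtain h where h: "linear h" "\<forall>x\<in>B. h x = f x"
    using linear_independent_extend[OF B(2)] by blast
  have f0: "f 0 = 0" using f(2)[of 0 0] S by (simp add: subspace_0)
  have "x \<in> S \<and> h x = f x" if "x \<in> span B" for x
    using that
  proof (induction rule: span_induct_alt)
    case base
    then show ?case using h(1) S by (simp add: linear_0 f0 subspace_0)
  next
    case (step c x y)
    then show ?case
      using B(1) S h f by (auto simp: linear_add linear_cmul subspace_add subspace_scale)
  qed
  then show thesis using that[OF h(1)] B(3) by blast
qed

lemma bounded_linear_moment_component: "bounded_linear (moment_component A)"
  unfolding moment_component_def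
  by (intro bounded_linear_compose[OF bounded_linear_Re] bounded_linear_compose[OF bounded_linear_trace]
      matrix_mult.bounded_linear_left)

section \<open>The unitary group, the orbit and differentials along exponential curves\<close>

context hermitian_symmetric_data begin

abbreviation "G \<equiv> connected_group g"
abbreviation "M \<equiv> adjoint_orbit G \<rho>"
abbreviation "T \<equiv> orbit_tangent g"

lemma mexp_g_dagger: "A \<in> g \<Longrightarrow> dagger (mexp A) = mexp (- A)"
proof -
  assume "A \<in> g"
  then have "dagger A ** mat 1 + mat 1 ** A = 0"
    by (simp add: g_antihermitian matrix_uminus_left)
  from mexp_antihomomorphism_invariant[OF bounded_linear_dagger dagger_mult dagger_mat_1 this]
  have "dagger (mexp A) ** mexp A = mat 1" by simp
  then show ?thesis
    by (metis mexp_uminus_inverse(2) matrix_mul_assoc matrix_mul_lid matrix_mul_rid)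
qed

lemma mexp_g_conjugate:
  "A \<in> g \<Longrightarrow> B \<in> g \<Longrightarrow> mexp A ** B ** mexp (- A) \<in> g"
  using mexp_conjugate_classical[OF classical, of A B] g_subset_gC mexp_g_dagger[of A]
    mexp_g_dagger[of "- A"] subspace_neg[OF subspace_g, of A]
  by (auto simp: g_def mem_compact_form dagger_simps matrix_ring_simps)

lemma G_unitary: "u \<in> G \<Longrightarrow> dagger u ** u = mat 1"
proof (induction rule: connected_group.induct)
  case (step A a)
  have "dagger (mexp A ** a) ** (mexp A ** a) = dagger a ** (dagger (mexp A) ** mexp A) ** a"
    by (simp add: dagger_mult matrix_mul_assoc)
  then show ?case
    using step by (simp add: mexp_g_dagger mexp_uminus_inverse)
qed simp

lemma G_unitary': "u \<in> G \<Longrightarrow> u ** dagger u = mat 1"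
  using G_unitary matrix_left_right_inverse by blast

lemma G_conjugate:
  assumes "u \<in> G" "B \<in> g"
  shows "u ** B ** dagger u \<in> g" "dagger u ** B ** u \<in> g"
proof -
  show "u ** B ** dagger u \<in> g"
    using assms
  proof (induction rule: connected_group.induct)
    case (step A a)
    then have "mexp A ** (a ** B ** dagger a) ** mexp (- A) \<in> g"
      by (intro mexp_g_conjugate)
    then show ?case
      using step by (simp add: dagger_mult mexp_g_dagger matrix_mul_assoc)
  qed simp
  show "dagger u ** B ** u \<in> g"
    using assms
  \<comment> \<open>Here the outermost exponential acts on B first, so the hypothesis is used at a
    conjugate of B.\<close>
  proof (induction arbitrary: B rule: connected_group.induct)
    case (step A a)
    have "- A \<in> g" using step subspace_neg[OF subspace_g] by blast
    then have "mexp (- A) ** B ** mexp A \<in> g"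
      using mexp_g_conjugate[of "- A" B] step by simp
    then have "dagger a ** (mexp (- A) ** B ** mexp A) ** a \<in> g"
      by (rule step.IH)
    then show ?case
      using step by (simp add: dagger_mult mexp_g_dagger matrix_mul_assoc)
  qed simp
qed

lemma orbit_map_G: "u \<in> G \<Longrightarrow> orbit_map \<rho> u = u ** \<rho> ** dagger u"
  by (simp add: orbit_map_def unitary_matrix_inv G_unitary)

lemma \<rho>_g: "\<rho> \<in> g"
  using \<rho>_t t_subset_g by blast

lemma M_subset_g: "M \<subseteq> g"
  by (auto simp: adjoint_orbit_def orbit_map_G G_conjugate \<rho>_g)

lemma T_subset_g: "x \<in> M \<Longrightarrow> T x \<subseteq> g"
  using M_subset_g lie_g by (auto simp: orbit_tangent_def)

lemma subspace_T: "subspace (T x)"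
  unfolding orbit_tangent_def subspace_def
proof (intro conjI ballI allI)
  show "0 \<in> {lie A x |A. A \<in> g}"
    using subspace_0[OF subspace_g] by (auto intro!: exI[of _ 0])
  show "v + w \<in> {lie A x |A. A \<in> g}" if "v \<in> {lie A x |A. A \<in> g}" "w \<in> {lie A x |A. A \<in> g}" for v w
    using that subspace_add[OF subspace_g] by (auto simp flip: lie_add_left)
  show "c *\<^sub>R v \<in> {lie A x |A. A \<in> g}" if "v \<in> {lie A x |A. A \<in> g}" for c v
    using that subspace_scale[OF subspace_g] by (auto simp flip: lie_scaleR_left)
qed

lemma orbit_map_mexp:
  "u \<in> G \<Longrightarrow> A \<in> g \<Longrightarrow> orbit_map \<rho> (mexp (s *\<^sub>R A) ** u) =
     mexp (s *\<^sub>R A) ** orbit_map \<rho> u ** mexp (s *\<^sub>R - A)"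
  using subspace_scale[OF subspace_g, of A s]
  by (simp add: orbit_map_G connected_group.step dagger_mult mexp_g_dagger matrix_mul_assoc)

lemma orbit_curve:
  assumes "x \<in> M" "A \<in> g"
  shows "mexp (s *\<^sub>R A) ** x ** mexp (s *\<^sub>R - A) \<in> M"
proof -
  obtain u where u: "u \<in> G" "x = orbit_map \<rho> u"
    using assms by (auto simp: adjoint_orbit_def)
  then have "mexp (s *\<^sub>R A) ** u \<in> G"
    using assms subspace_scale[OF subspace_g] by (auto intro: connected_group.step)
  then show ?thesis
    unfolding u(2) orbit_map_mexp[OF u(1) assms(2), symmetric] adjoint_orbit_def by (rule imageI)
qed

text \<open>Tangent vectors are velocities of conjugation curves in the orbit. Agreement of
  \<open>F\<close> and \<open>L\<close> on \<open>g\<close> is what the linear extension of a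
  representation provides.\<close>

lemma orbit_differential:
  assumes "bounded_linear L" "\<And>y. y \<in> g \<Longrightarrow> F y = L y" "x \<in> M" "v \<in> T x"
  shows "differential M T F x v = L v"
proof -
  obtain A where A: "A \<in> g" "v = lie A x"
    using assms(4) by (auto simp: orbit_tangent_def)
  show ?thesis
  proof (rule bounded_linear_differential_curve[where c = "\<lambda>s. mexp (s *\<^sub>R A) ** x ** mexp (s *\<^sub>R - A)"])
    show "((\<lambda>s. mexp (s *\<^sub>R A) ** x ** mexp (s *\<^sub>R - A)) has_vector_derivative v) (at 0)"
      using mexp_conjugation_has_vector_derivative[of A x 0] by (simp add: A)
  qed (use assms M_subset_g A orbit_curve in auto)
qed

lemma differential_moment_component:
  assumes "x \<in> M"
  shows "differential M T (moment_component A) x v = (if v \<in> T x then Re (trace (v ** A)) else 0)"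
  using orbit_differential[OF bounded_linear_moment_component refl assms, of v A]
  by (cases "v \<in> T x") (simp_all add: moment_component_def[of A v] differential_def)

lemma differential_pullback:
  assumes "u \<in> G" "B \<in> g"
  shows "differential G (group_tangent g) (moment_component A \<circ> orbit_map \<rho>) u (B ** u)
    = Re (trace (lie B (orbit_map \<rho> u) ** A))"
proof (rule differential_curve[where c = "\<lambda>s. mexp (s *\<^sub>R B) ** u"])
  define x where "x = orbit_map \<rho> u"
  \<comment> \<open>On the group the inverse in \<open>orbit_map\<close> is the adjoint, which is
    linear and so gives differentiability.\<close>
  let ?F = "\<lambda>a. moment_component A (a ** \<rho> ** dagger a)"
  have "((\<lambda>a. a ** \<rho> ** dagger a) has_derivative
      (\<lambda>h. u ** \<rho> ** dagger h + h ** \<rho> ** dagger u)) (at u within G)"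
    by (intro matrix_mult.FDERIV bounded_linear_imp_has_derivative bounded_linear_dagger
        matrix_mult.bounded_linear_left)
  then have "?F differentiable (at u within G)"
    using bounded_linear.has_derivative[OF bounded_linear_moment_component]
    unfolding differentiable_def by blast
  then show "(moment_component A \<circ> orbit_map \<rho>) differentiable (at u within G)"
    using assms by (auto intro!: differentiable_transform_within[where f = ?F and d = 1] simp: orbit_map_G)
  show "B ** u \<in> group_tangent g u"
    using assms by (auto simp: group_tangent_def)
  show "mexp (s *\<^sub>R B) ** u \<in> G" for s
    using assms subspace_scale[OF subspace_g] by (auto intro: connected_group.step)
  show "((\<lambda>s. mexp (s *\<^sub>R B) ** u) has_vector_derivative B ** u) (at 0)"
    using bounded_linear.has_vector_derivative[OF matrix_mult.bounded_linear_left[of u]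
        mexp_has_vector_derivative[of B 0]] by simp
  have "((\<lambda>s. mexp (s *\<^sub>R B) ** x ** mexp (s *\<^sub>R - B)) has_vector_derivative lie B x) (at 0)"
    using mexp_conjugation_has_vector_derivative[of B x 0] by simp
  from bounded_linear.has_vector_derivative[OF bounded_linear_moment_component this]
  show "((\<lambda>s. (moment_component A \<circ> orbit_map \<rho>) (mexp (s *\<^sub>R B) ** u)) has_vector_derivative
      Re (trace (lie B (orbit_map \<rho> u) ** A))) (at 0)"
    using assms by (simp add: orbit_map_mexp[simplified] x_def moment_component_def)
qed simp

end

section \<open>The Nijenhuis tensor\<close>

context hermitian_symmetric_data begin

abbreviation "d\<mu> A x \<equiv> differential M T (moment_component A) x"

text \<open>The real trace form is negative definite on \<open>g\<close>; test it on X - Y.\<close>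

lemma g_nondegenerate:
  assumes "X \<in> g" "Y \<in> g" "\<And>A. A \<in> g \<Longrightarrow> Re (trace (X ** A)) = Re (trace (Y ** A))"
  shows "X = Y"
proof -
  have "X - Y \<in> g" using assms(1,2) subspace_g by (rule_tac subspace_diff)
  moreover from assms(3)[OF this] have "Re (trace ((X - Y) ** (X - Y))) = 0"
    by (simp add: matrix_ring_simps trace_sub)
  ultimately have "(X - Y) \<bullet> (X - Y) = 0"
    by (simp add: inner_antihermitian g_antihermitian)
  then show ?thesis by simp
qed

lemma cotangent_d\<mu>:
  assumes "x \<in> M"
  shows "d\<mu> A x \<in> cotangent T x"
  unfolding cotangent_def
  using subspace_add[OF subspace_T, of _ x] subspace_scale[OF subspace_T, of _ x]
  by (auto simp: differential_moment_component[OF assms] matrix_ring_simps trace_add trace_scaleR)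

lemma cotangent_imp_d\<mu>:
  assumes "x \<in> M" "a \<in> cotangent T x"
  obtains B where "B \<in> g" "a = d\<mu> B x"
proof -
  have a: "\<And>v w. v \<in> T x \<Longrightarrow> w \<in> T x \<Longrightarrow> a (v + w) = a v + a w"
    "\<And>c v. v \<in> T x \<Longrightarrow> a (c *\<^sub>R v) = c *\<^sub>R a v" and a0: "\<And>v. v \<notin> T x \<Longrightarrow> a v = 0"
    using assms(2) by (auto simp: cotangent_def)
  obtain h where h: "linear h" "\<And>v. v \<in> T x \<Longrightarrow> h v = a v"
    using linear_extension[OF subspace_T a] by metis
  \<comment> \<open>The adjoint applied to 1 is the Riesz vector of \<open>h\<close>. Projecting it
    to the tangent space places it in \<open>g\<close> without changing its pairing with tangent
    vectors; the sign in -y comes from \<open>inner_antihermitian\<close>.\<close>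
  obtain y z where yz: "y \<in> span (T x)" "\<And>w. w \<in> span (T x) \<Longrightarrow> orthogonal z w" "adjoint h 1 = y + z"
    using orthogonal_subspace_decomp_exists by metis
  have y: "y \<in> g"
    using yz(1) T_subset_g[OF assms(1)] subspace_T by (metis span_eq_iff subsetD)
  have "a v = d\<mu> (- y) x v" for v
  proof (cases "v \<in> T x")
    case True
    have "a v = v \<bullet> adjoint h 1"
      using adjoint_works[OF h(1), of v 1] h(2)[OF True] by simp
    also have "\<dots> = v \<bullet> y"
      using yz(2)[of v] True by (simp add: yz(3) inner_add_right span_base orthogonal_def inner_commute)
    also have "\<dots> = Re (trace (v ** - y))"
      using True T_subset_g[OF assms(1)]
      by (auto simp: inner_antihermitian g_antihermitian matrix_uminus_right trace_uminus)
    finally show ?thesis by (simp add: differential_moment_component[OF assms(1)] True)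
  qed (simp add: differential_moment_component[OF assms(1)] a0)
  then show thesis using that[of "- y"] y subspace_neg[OF subspace_g] by blast
qed

text \<open>All covectors have the form \<open>d\<mu> B x\<close>, and nondegeneracy of the trace
  form gives the uniqueness demanded by the definite description.\<close>

lemma sharp_eqI:
  assumes x: "x \<in> M" and v: "v \<in> T x"
    and P: "\<And>B. B \<in> g \<Longrightarrow> P x a (d\<mu> B x) = Re (trace (v ** B))"
  shows "sharp T P x a = v"
  unfolding sharp_def
proof (rule the_equality)
  show "v \<in> T x \<and> (\<forall>b\<in>cotangent T x. b v = P x a b)"
    using v P cotangent_imp_d\<mu>[OF x] by (metis differential_moment_component[OF x])
  fix w assume w: "w \<in> T x \<and> (\<forall>b\<in>cotangent T x. b w = P x a b)"
  show "w = v"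
  proof (rule g_nondegenerate)
    show "w \<in> g" "v \<in> g" using v w T_subset_g[OF x] by auto
    fix B assume "B \<in> g"
    then show "Re (trace (w ** B)) = Re (trace (v ** B))"
      using w P cotangent_d\<mu>[OF x, of B] by (metis differential_moment_component[OF x])
  qed
qed

text \<open>Invariance of the trace gives Tr (x [A, B]) = Tr ([x, A] B), so [x, A] is the
  Hamiltonian vector of Tr (x A).\<close>

lemma sharp_kks:
  assumes kks: "is_kks g M P" and x: "x \<in> M" and A: "A \<in> g"
  shows "sharp T P x (d\<mu> A x) = lie x A"
proof (rule sharp_eqI[OF x])
  have "lie x A = lie (- A) x" by (simp add: lie_uminus_left flip: lie_commute)
  then show "lie x A \<in> T x"
    using subspace_neg[OF subspace_g A] by (auto simp: orbit_tangent_def)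
  show "P x (d\<mu> A x) (d\<mu> B x) = Re (trace (lie x A ** B))" if "B \<in> g" for B
  proof -
    have "P x (d\<mu> A x) (d\<mu> B x) = Re (trace (x ** lie A B))"
      using kks A that x by (simp add: is_kks_def poisson_bracket_def moment_component_def)
    also have "trace (x ** lie A B) = trace (lie x A ** B)"
      by (metis trace_lie trace_mul_sym)
    finally show ?thesis .
  qed
qed

lemma flat_kks:
  assumes kks: "is_kks g M P" and x: "x \<in> M" and A: "A \<in> g"
  shows "symplectic_flat T P x (lie A x) = d\<mu> (- A) x"
  unfolding symplectic_flat_def
proof (rule the_equality)
  have A': "- A \<in> g" using A subspace_neg[OF subspace_g] by blast
  have lie: "lie x (- A) = lie A x" by (simp add: lie_uminus_right flip: lie_commute)
  show "d\<mu> (- A) x \<in> cotangent T x \<and> sharp T P x (d\<mu> (- A) x) = lie A x"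
    using sharp_kks[OF kks x A'] cotangent_d\<mu>[OF x] by (simp add: lie)
  fix a assume a: "a \<in> cotangent T x \<and> sharp T P x a = lie A x"
  then obtain B where B: "B \<in> g" "a = d\<mu> B x"
    using cotangent_imp_d\<mu>[OF x] by blast
  then have eq: "lie x B = lie x (- A)"
    using a sharp_kks[OF kks x B(1)] by (simp add: lie)
  \<comment> \<open>\<open>B\<close> is fixed only up to the centralizer of \<open>x\<close>, but
    its pairing with a tangent vector [C, x] depends on [x, B] alone.\<close>
  have "Re (trace (v ** B)) = Re (trace (v ** - A))" if "v \<in> T x" for v
  proof -
    obtain C where "v = lie C x" using \<open>v \<in> T x\<close> by (auto simp: orbit_tangent_def)
    moreover have "trace (lie C x ** D) = trace (C ** lie x D)" for D
      by (metis trace_lie trace_mul_sym)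
    ultimately show ?thesis by (simp add: eq)
  qed
  then show "a = d\<mu> (- A) x"
    unfolding B(2) by (auto simp: differential_moment_component[OF x])
qed

text \<open>Split i X - K as (J X - K) + (i X - J X). Uniqueness holds because \<open>g\<close>
  meets i g only in zero. The argument has the shape that \<open>C_minus J \<xi>\<close> takes after
  conjugation by a group element.\<close>

lemma iwasawa_projections:
  assumes X: "X \<in> g" and K: "K \<in> g"
  shows "pr_g g J (\<i> *\<^sub>C X - K) = J X - K" "pr_b g J (\<i> *\<^sub>C X - K) = C_minus J X"
proof -
  have imaginary: "X = Y" if "X \<in> g" "Y \<in> g" "\<i> *\<^sub>C X - \<i> *\<^sub>C Y \<in> g" for X Y
  proof -
    define D where "D = X - Y"
    have "D \<in> g" "\<i> *\<^sub>C D \<in> g"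
      using that subspace_diff[OF subspace_g] by (auto simp: D_def cscale_diff)
    then have "dagger D = - D" "dagger (\<i> *\<^sub>C D) = - (\<i> *\<^sub>C D)"
      by (auto intro: g_antihermitian)
    then have "(2 * \<i>) *\<^sub>C D = 0"
      by (simp add: dagger_cscale cscale_uminus_left cscale_uminus vec_eq_iff)
    then show ?thesis by (simp add: D_def)
  qed
  have unique: "Y = X" if "Y \<in> g" "\<i> *\<^sub>C X - K - Z = C_minus J Y" "Z \<in> g" for Y Z
  proof (rule imaginary[symmetric])
    have "\<i> *\<^sub>C X - \<i> *\<^sub>C Y = K + Z - J Y"
      using that(2) by (simp add: C_minus_def algebra_simps)
    also have "\<dots> \<in> g"
      using that K J_g by (intro subspace_diff subspace_add subspace_g)
    finally show "\<i> *\<^sub>C X - \<i> *\<^sub>C Y \<in> g" .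
  qed (use that X in auto)
  have decomposition: "J X - K \<in> g" "\<i> *\<^sub>C X - K - (J X - K) = C_minus J X"
    using X K J_g subspace_diff[OF subspace_g] by (auto simp: C_minus_def)
  show "pr_g g J (\<i> *\<^sub>C X - K) = J X - K"
    unfolding pr_g_def
  proof (rule the_equality)
    show "J X - K \<in> g \<and> \<i> *\<^sub>C X - K - (J X - K) \<in> C_minus J ` g"
      using decomposition X by auto
    fix Z assume Z: "Z \<in> g \<and> \<i> *\<^sub>C X - K - Z \<in> C_minus J ` g"
    then obtain Y where Y: "Y \<in> g" "\<i> *\<^sub>C X - K - Z = C_minus J Y"
      by auto
    with unique Z have "\<i> *\<^sub>C X - K - Z = C_minus J X" by blast
    then show "Z = J X - K"
      by (simp add: C_minus_def algebra_simps)
  qed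
  show "pr_b g J (\<i> *\<^sub>C X - K) = C_minus J X"
    unfolding pr_b_def
  proof (rule the_equality)
    show "C_minus J X \<in> C_minus J ` g \<and> \<i> *\<^sub>C X - K - C_minus J X \<in> g"
      using X decomposition by (auto simp: C_minus_def algebra_simps)
    fix Z assume Z: "Z \<in> C_minus J ` g \<and> \<i> *\<^sub>C X - K - Z \<in> g"
    then obtain Y where Y: "Y \<in> g" "Z = C_minus J Y"
      by auto
    have "\<i> *\<^sub>C X - K - (\<i> *\<^sub>C X - K - Z) = C_minus J Y" using Y by simp
    with unique Y Z have "Y = X" by blast
    then show "Z = C_minus J X" using Y by simp
  qed
qed

section \<open>The Poisson-Lie bivector on pulled-back covectors\<close>

lemma right_trivialize_d\<mu>:
  assumes u: "u \<in> G" and A: "A \<in> g"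
  shows "right_trivialize g u (differential G (group_tangent g) (moment_component A \<circ> orbit_map \<rho>) u)
    = lie (orbit_map \<rho> u) A"
proof -
  let ?x = "orbit_map \<rho> u"
  have xg: "lie ?x A \<in> g"
    using u A M_subset_g by (intro lie_g) (auto simp: adjoint_orbit_def)
  have *: "differential G (group_tangent g) (moment_component A \<circ> orbit_map \<rho>) u (B ** u)
      = Re (trace (lie ?x A ** B))" if "B \<in> g" for B
  proof -
    have "trace (lie B ?x ** A) = trace (?x ** lie A B)" by (rule trace_lie)
    also have "\<dots> = trace (lie ?x A ** B)" by (metis trace_lie trace_mul_sym)
    finally show ?thesis by (simp add: differential_pullback[OF u that])
  qed
  show ?thesis
    unfolding right_trivialize_def
  proof (rule the_equality)
    fix \<xi> assume "\<xi> \<in> g \<and> (\<forall>B\<in>g. Re (trace (\<xi> ** B)) =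
        differential G (group_tangent g) (moment_component A \<circ> orbit_map \<rho>) u (B ** u))"
    then show "\<xi> = lie ?x A"
      using * xg by (intro g_nondegenerate) auto
  qed (use xg * in auto)
qed

lemma trace_conjugate:
  assumes "u \<in> G"
  shows "trace ((dagger u ** X ** u) ** (dagger u ** Y ** u)) = trace (X ** Y)"
proof -
  have "(dagger u ** X ** u) ** (dagger u ** Y ** u) = dagger u ** (X ** (u ** dagger u) ** Y ** u)"
    by (simp add: matrix_mul_assoc)
  also have "\<dots> = dagger u ** (X ** Y ** u)"
    by (simp add: G_unitary'[OF assms])
  also have "trace \<dots> = trace (X ** Y ** (u ** dagger u))"
    by (metis trace_mul_sym matrix_mul_assoc)
  finally show ?thesis by (simp add: G_unitary'[OF assms])
qed

lemma lie_conjugate: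
  assumes "u \<in> G"
  shows "dagger u ** lie X Y ** u = lie (dagger u ** X ** u) (dagger u ** Y ** u)"
proof -
  have "(dagger u ** X ** u) ** (dagger u ** Y ** u) = dagger u ** (X ** Y) ** u" for X Y
  proof -
    have "(dagger u ** X ** u) ** (dagger u ** Y ** u) = dagger u ** X ** (u ** dagger u) ** Y ** u"
      by (simp add: matrix_mul_assoc)
    then show ?thesis by (simp add: G_unitary'[OF assms] matrix_mul_assoc)
  qed
  then show ?thesis by (simp add: lie_def matrix_diff_ldistrib matrix_diff_rdistrib)
qed

lemma conjugate_\<rho>:
  assumes "u \<in> G"
  shows "dagger u ** orbit_map \<rho> u ** u = \<rho>"
proof -
  have "dagger u ** orbit_map \<rho> u ** u = (dagger u ** u) ** \<rho> ** (dagger u ** u)"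
    by (simp add: orbit_map_G[OF assms] matrix_mul_assoc)
  then show ?thesis by (simp add: G_unitary[OF assms])
qed

text \<open>On \<open>[\<rho>, g]\<close> the map \<open>J\<close> is \<open>ad \<rho>\<close>; so \<open>Ad u \<circ> J \<circ> Ad u\<^sup>-\<^sup>1\<close>, which a priori depends on \<open>u\<close>, is
  \<open>ad x\<close> on the tangent space at \<open>x = u \<rho> u\<^sup>-\<^sup>1\<close>.\<close>

lemma poisson_lie_d\<mu>:
  assumes u: "u \<in> G" and A: "A \<in> g" and B: "B \<in> g"
  defines "x \<equiv> orbit_map \<rho> u"
  shows "poisson_lie g J u (differential G (group_tangent g) (moment_component A \<circ> orbit_map \<rho>) u)
      (differential G (group_tangent g) (moment_component B \<circ> orbit_map \<rho>) u)
    = Re (trace ((lie x A + lie x (J (lie x A))) ** B))"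
proof -
  define \<xi> \<eta> where "\<xi> = lie x A" and "\<eta> = lie x B"
  define c where "c = (\<lambda>X. dagger u ** X ** u)"
  have xg: "x \<in> g" using u M_subset_g by (auto simp: x_def adjoint_orbit_def)
  have \<xi>g: "\<xi> \<in> g" and \<eta>g: "\<eta> \<in> g" using xg A B lie_g by (auto simp: \<xi>_def \<eta>_def)
  have cg: "X \<in> g \<Longrightarrow> c X \<in> g" for X using G_conjugate(2)[OF u] by (simp add: c_def)
  have c_C: "matrix_inv u ** C_minus J X ** u = \<i> *\<^sub>C c X - c (J X)" for X
    by (simp add: unitary_matrix_inv G_unitary u C_minus_def c_def matrix_ring_simps)
  have c\<xi>: "c \<xi> = lie \<rho> (c A)"
    by (simp add: c_def \<xi>_def x_def lie_conjugate u conjugate_\<rho>)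
  have cA: "c A \<in> gC" using cg[OF A] g_subset_gC by blast
  have J\<xi>: "J (c \<xi>) = c (lie x \<xi>)"
    by (simp add: c\<xi> J_eq_ad_\<rho>(1)[OF cA]) (simp add: c_def x_def lie_conjugate u conjugate_\<rho> flip: c\<xi>[unfolded c_def])
  \<comment> \<open>The cubic relation of ad \<rho> is carried to \<open>x\<close> by conjugation
    with \<open>u\<close>.\<close>
  have ad3: "lie x (lie x \<xi>) = - lie x A"
  proof -
    have "c (lie x (lie x \<xi>)) = lie \<rho> (lie \<rho> (lie \<rho> (c A)))"
      by (simp add: c_def x_def \<xi>_def lie_conjugate u conjugate_\<rho>)
    also have "\<dots> = - c \<xi>"
      unfolding c\<xi> by (rule J_eq_ad_\<rho>(2)[OF cA])
    also have "\<dots> = c (- lie x A)"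
      by (simp add: c_def \<xi>_def matrix_ring_simps)
    finally have "u ** c (lie x (lie x \<xi>)) ** dagger u = u ** c (- lie x A) ** dagger u" by simp
    moreover have "u ** c X ** dagger u = X" for X
    proof -
      have "u ** c X ** dagger u = (u ** dagger u) ** X ** (u ** dagger u)"
        by (simp add: c_def matrix_mul_assoc)
      then show ?thesis by (simp add: G_unitary'[OF u])
    qed
    ultimately show ?thesis by simp
  qed
  have "poisson_lie g J u (differential G (group_tangent g) (moment_component A \<circ> orbit_map \<rho>) u)
      (differential G (group_tangent g) (moment_component B \<circ> orbit_map \<rho>) u)
    = Im (trace ((J (c \<xi>) - c (J \<xi>)) ** C_minus J (c \<eta>)))"
    using iwasawa_projections[OF cg[OF \<xi>g] cg[OF J_g[OF \<xi>g]]] iwasawa_projections[OF cg[OF \<eta>g] cg[OF J_g[OF \<eta>g]]]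
    by (simp add: poisson_lie_def right_trivialize_d\<mu>[OF u A] right_trivialize_d\<mu>[OF u B] Let_def c_C
        flip: x_def \<xi>_def \<eta>_def)
  \<comment> \<open>The summand i c \<eta> of \<open>C_minus J (c \<eta>)\<close> turns the
    imaginary part into a real part; the other summand contributes a real trace.\<close>
  also have "\<dots> = Re (trace ((J (c \<xi>) - c (J \<xi>)) ** c \<eta>))"
  proof -
    have "J (c \<xi>) - c (J \<xi>) \<in> g"
      by (intro subspace_diff subspace_g cg J_g \<xi>g)
    then have "Im (trace ((J (c \<xi>) - c (J \<xi>)) ** J (c \<eta>))) = 0"
      by (intro trace_antihermitian_real g_antihermitian cg J_g \<eta>g)
    then show ?thesis
      by (simp add: C_minus_def matrix_diff_ldistrib cscale_mult_right trace_sub trace_cscale)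
  qed
  also have "J (c \<xi>) - c (J \<xi>) = c (lie x \<xi> - J \<xi>)"
    by (simp add: J\<xi>) (simp add: c_def matrix_ring_simps)
  also have "trace (c (lie x \<xi> - J \<xi>) ** c \<eta>) = trace ((lie x \<xi> - J \<xi>) ** lie x B)"
    unfolding c_def trace_conjugate[OF u] \<eta>_def ..
  also have "\<dots> = trace (lie (lie x \<xi> - J \<xi>) x ** B)"
    by (metis trace_lie trace_mul_sym)
  \<comment> \<open>By \<open>ad3\<close> the double bracket of \<open>x\<close> with \<xi> = [x, A]
    is -\<xi>, which produces the summand \<xi>.\<close>
  also have "lie (lie x \<xi> - J \<xi>) x = \<xi> + lie x (J \<xi>)"
    using ad3 by (simp add: lie_commute[of _ x] lie_diff_right \<xi>_def)
  finally show ?thesis unfolding \<xi>_def .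
qed

lemma nijenhuis_eq:
  assumes kks: "is_kks g M P\<^sub>k"
    and P\<^sub>0: "poisson_map G (group_tangent g) (poisson_lie g J) M T P\<^sub>0 (orbit_map \<rho>)"
    and x: "x \<in> M" and v: "v \<in> T x"
  shows "v + lie x (J v) \<in> T x" "nijenhuis T P\<^sub>0 P\<^sub>k x v = v + lie x (J v)"
proof -
  obtain A where A: "A \<in> g" "v = lie A x"
    using v by (auto simp: orbit_tangent_def)
  obtain u where u: "u \<in> G" "x = orbit_map \<rho> u"
    using x by (auto simp: adjoint_orbit_def)
  have vg: "v \<in> g" using v T_subset_g[OF x] by blast
  have A': "- A \<in> g" and xA: "lie x (- A) = v"
    using A subspace_neg[OF subspace_g] by (auto simp: lie_uminus_right lie_commute[of x])
  \<comment> \<open>As v = [A, x], the correction [x, J v] amounts to replacing A by A - J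
    v.\<close>
  have "v + lie x (J v) = lie (A - J v) x"
    by (simp add: A(2) lie_diff_left lie_commute[of x])
  then show T: "v + lie x (J v) \<in> T x"
    using A(1) J_g[OF vg] subspace_diff[OF subspace_g] by (auto simp: orbit_tangent_def)
  have "P\<^sub>0 x (d\<mu> (- A) x) (d\<mu> B x) = Re (trace ((v + lie x (J v)) ** B))" if B: "B \<in> g" for B
  proof -
    \<comment> \<open>The bracket on the orbit is computed at a point \<open>u\<close> above
      \<open>x\<close>; the sign in -A is that of \<open>flat_kks\<close>.\<close>
    have "poisson_bracket G (group_tangent g) (poisson_lie g J) (moment_component (- A) \<circ> orbit_map \<rho>)
        (moment_component B \<circ> orbit_map \<rho>) u
      = poisson_bracket M T P\<^sub>0 (moment_component (- A)) (moment_component B) (orbit_map \<rho> u)"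
      using P\<^sub>0 u(1) bounded_linear_smooth_fun[OF bounded_linear_moment_component]
      unfolding poisson_map_def by blast
    then show ?thesis
      using poisson_lie_d\<mu>[OF u(1) A' B] by (simp add: poisson_bracket_def xA flip: u(2))
  qed
  then show "nijenhuis T P\<^sub>0 P\<^sub>k x v = v + lie x (J v)"
    unfolding nijenhuis_def A(2) flat_kks[OF kks x A(1)]
    unfolding A(2)[symmetric] using sharp_eqI[OF x T] by blast
qed

end

section \<open>Representations\<close>

lemma conjugate_square:
  fixes E F X :: "complex^'m^'m"
  assumes "F ** E = mat 1" "X ** X = a *\<^sub>C X - b *\<^sub>C mat 1"
  shows "(E ** X ** F) ** (E ** X ** F) = a *\<^sub>C (E ** X ** F) - b *\<^sub>C mat 1"
proof -
  have "E ** F = mat 1" using assms(1) matrix_left_right_inverse by blast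
  have "(E ** X ** F) ** (E ** X ** F) = E ** (X ** (F ** E) ** X) ** F"
    by (simp add: matrix_mul_assoc)
  also have "\<dots> = a *\<^sub>C (E ** X ** F) - b *\<^sub>C (E ** F)"
    by (simp add: assms matrix_ring_simps)
  finally show ?thesis by (simp add: \<open>E ** F = mat 1\<close>)
qed

lemma mult_cscale_vector: "(c *\<^sub>C A) *v v = c *s (A *v v)"
  by (simp add: matrix_vector_mult_def vec_eq_iff sum_distrib_left mult_ac)

text \<open>The space is a sum of two subspaces on which R \<rho> is a scalar, so (z - rp)(z - rm)
  annihilates R \<rho>.\<close>

lemma decomposable_square:
  assumes "decomposable R \<rho> rp rm"
  shows "R \<rho> ** R \<rho> = (rp + rm) *\<^sub>C R \<rho> - (rp * rm) *\<^sub>C mat 1"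
proof -
  let ?X = "R \<rho>"
  obtain Vp Vm where V: "\<And>v. \<exists>a\<in>Vp. \<exists>b\<in>Vm. v = a + b"
    "\<And>v. v \<in> Vp \<Longrightarrow> ?X *v v = rp *s v" "\<And>v. v \<in> Vm \<Longrightarrow> ?X *v v = rm *s v"
    using assms unfolding decomposable_def Let_def by blast
  have "(?X ** ?X) *v v = ((rp + rm) *\<^sub>C ?X - (rp * rm) *\<^sub>C mat 1) *v v" for v
  proof -
    obtain a b where "a \<in> Vp" "b \<in> Vm" "v = a + b" using V(1) by blast
    moreover from this have "?X *v a = rp *s a" "?X *v b = rm *s b" using V by auto
    ultimately show ?thesis
      by (simp add: matrix_vector_mul_assoc[symmetric] matrix_vector_right_distrib
          matrix_vector_mult_diff_rdistrib mult_cscale_vector matrix_vector_mult_scaleR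
          vector_scalar_commute)
        (simp add: vec_eq_iff algebra_simps)
  qed
  then show ?thesis by (simp add: matrix_eq)
qed

text \<open>Bracketing with \<open>A\<close> is a derivation; this is the quadratic relation
  differentiated along [A, X].\<close>

lemma derivation_square:
  assumes "X ** X = a *\<^sub>C X - b *\<^sub>C (mat 1 :: complex^'m^'m)"
  shows "lie A X ** X + X ** lie A X = a *\<^sub>C lie A X"
proof -
  have "lie A X ** X + X ** lie A X = lie A (X ** X)"
    by (simp add: lie_def matrix_ring_simps)
  also have "\<dots> = a *\<^sub>C lie A X - b *\<^sub>C lie A (mat 1)"
    by (simp add: assms lie_diff_right lie_cscale_right)
  finally show ?thesis by (simp add: lie_def)
qed

section \<open>The quadratic relation along the orbit and the final formulas\<close>

context hermitian_symmetric_data begin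

text \<open>Plays the role of the integrated representation. Undoing conjugation by exp (s R A) on
  the image of the curve Ad (exp (s A)) B leaves a constant curve \<open>K\<close>.\<close>

lemma representation_mexp:
  assumes R: "lie_representation g R" and A: "A \<in> g" and B: "B \<in> g"
  shows "R (mexp A ** B ** mexp (- A)) = mexp (R A) ** R B ** mexp (- R A)"
proof -
  obtain h where h: "linear h" "\<And>X. X \<in> g \<Longrightarrow> h X = R X"
    using linear_extension[OF subspace_g, of R] R unfolding lie_representation_def by metis
  have bh: "bounded_linear h" using h(1) by (simp add: linear_conv_bounded_linear)
  define Y where "Y = (\<lambda>s. mexp (s *\<^sub>R A) ** B ** mexp (s *\<^sub>R - A))"
  define E F where "E = (\<lambda>s. mexp (s *\<^sub>R R A))" and "F = (\<lambda>s. mexp (s *\<^sub>R - R A))"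
  define K where "K = (\<lambda>s. F s ** h (Y s) ** E s)"
  have Y: "Y s \<in> g" for s
    using mexp_g_conjugate[of "s *\<^sub>R A" B] A B subspace_scale[OF subspace_g] by (simp add: Y_def)
  have "(K has_vector_derivative 0) (at s)" for s
  proof -
    have "((\<lambda>s. h (Y s)) has_vector_derivative h (lie A (Y s))) (at s)"
      unfolding Y_def
      by (rule bounded_linear.has_vector_derivative[OF bh mexp_conjugation_has_vector_derivative])
    moreover have "h (lie A (Y s)) = lie (R A) (h (Y s))"
      using Y A R by (simp add: h(2) lie_g lie_representation_def)
    ultimately have hY: "((\<lambda>s. h (Y s)) has_vector_derivative lie (R A) (h (Y s))) (at s)"
      by simp
    have F: "(F has_vector_derivative - (F s ** R A)) (at s)"
      using mexp_has_vector_derivative[of "- R A" s] unfolding F_def mexp_commute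
      by (simp add: matrix_uminus_right)
    have E: "(E has_vector_derivative R A ** E s) (at s)"
      unfolding E_def by (rule mexp_has_vector_derivative)
    have "(K has_vector_derivative F s ** h (Y s) ** (R A ** E s) +
        (F s ** lie (R A) (h (Y s)) + - (F s ** R A) ** h (Y s)) ** E s) (at s)"
      unfolding K_def by (intro matrix_mult.has_vector_derivative F E hY)
    then show ?thesis by (simp add: lie_def matrix_ring_simps)
  qed
  from zero_vector_derivative_const[OF this, of 1]
  have "mexp (- R A) ** R (mexp A ** B ** mexp (- A)) ** mexp (R A) = R B"
    using Y[of 1] B by (simp add: K_def E_def F_def Y_def h(2))
  then have "mexp (R A) ** R B ** mexp (- R A)
    = (mexp (R A) ** mexp (- R A)) ** R (mexp A ** B ** mexp (- A)) ** (mexp (R A) ** mexp (- R A))"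
    by (metis matrix_mul_assoc)
  then show ?thesis by (simp add: mexp_uminus_inverse)
qed

text \<open>Group elements are words in exponentials, and by \<open>representation_mexp\<close> each
  letter conjugates the matrix, which keeps the relation valid at \<rho>.\<close>

lemma representation_square:
  assumes R: "lie_representation g R" "decomposable R \<rho> rp rm" and x: "x \<in> M"
  shows "R x ** R x = (rp + rm) *\<^sub>C R x - (rp * rm) *\<^sub>C mat 1"
proof -
  obtain u where u: "u \<in> G" "x = orbit_map \<rho> u"
    using x by (auto simp: adjoint_orbit_def)
  have "R (orbit_map \<rho> u) ** R (orbit_map \<rho> u) = (rp + rm) *\<^sub>C R (orbit_map \<rho> u) - (rp * rm) *\<^sub>C mat 1"
    using u(1)
  proof (induction rule: connected_group.induct)
    case one
    then show ?case
      using decomposable_square[OF R(2)] by (simp add: orbit_map_G connected_group.one)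
  next
    case (step A a)
    have "orbit_map \<rho> a \<in> g"
      using step M_subset_g by (auto simp: adjoint_orbit_def)
    then have "R (orbit_map \<rho> (mexp A ** a)) = mexp (R A) ** R (orbit_map \<rho> a) ** mexp (- R A)"
      using representation_mexp[OF R(1) step(1)] orbit_map_mexp[OF step(2,1), of 1] by simp
    then show ?case
      using conjugate_square[OF mexp_uminus_inverse(1) step.IH] by simp
  qed
  then show ?thesis by (simp add: u(2))
qed

text \<open>Fits \<open>C_plus\<close> and \<open>C_minus\<close>, whose values at v in
  \<open>g\<close> are i v plus or minus J v with J v in \<open>g\<close>.\<close>

lemma complex_extension_eq:
  assumes "X \<in> g" "Y \<in> g"
  shows "complex_extension R (\<i> *\<^sub>C X + Y) = R Y + \<i> *\<^sub>C R X"
proof -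
  have "dagger (\<i> *\<^sub>C X + Y) = \<i> *\<^sub>C X - Y"
    using assms g_antihermitian by (simp add: dagger_simps cscale_uminus cscale_uminus_left)
  then have "(1/2) *\<^sub>C (\<i> *\<^sub>C X + Y - dagger (\<i> *\<^sub>C X + Y)) = Y"
    "(1 / (2 * \<i>)) *\<^sub>C (\<i> *\<^sub>C X + Y + dagger (\<i> *\<^sub>C X + Y)) = X"
    by (simp_all add: vec_eq_iff)
  then show ?thesis by (simp add: complex_extension_def)
qed

lemma differential_representation:
  assumes R: "lie_representation g R" and "x \<in> M" "v \<in> T x"
  shows "differential M T R x v = R v"
proof -
  obtain h where h: "linear h" "\<And>X. X \<in> g \<Longrightarrow> h X = R X"
    using linear_extension[OF subspace_g, of R] R unfolding lie_representation_def by metis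
  have "differential M T R x v = h v"
    by (rule orbit_differential) (use assms h in \<open>auto simp: linear_conv_bounded_linear\<close>)
  then show ?thesis using h(2) assms T_subset_g by auto
qed

lemma nijenhuis_dual_representation:
  assumes R: "lie_representation g R" "decomposable R \<rho> rp rm"
    and kks: "is_kks g M P\<^sub>k"
    and P\<^sub>0: "poisson_map G (group_tangent g) (poisson_lie g J) M T P\<^sub>0 (orbit_map \<rho>)"
    and x: "x \<in> M" and v: "v \<in> T x"
  defines "Dplus \<equiv> complex_extension R (C_plus J (differential M T (\<lambda>x. x) x v))"
    and "Dminus \<equiv> complex_extension R (C_minus J (differential M T (\<lambda>x. x) x v))"
    and "N \<equiv> nijenhuis T P\<^sub>0 P\<^sub>k"
  shows "dual_map N (differential M T R) x v =
      Dminus ** R x + R x ** Dplus - (2 * \<i> * rp) *\<^sub>C differential M T R x v"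
    and "dual_map N (differential M T R) x v =
      - (Dplus ** R x) - R x ** Dminus + (2 * \<i> * rm) *\<^sub>C differential M T R x v"
proof -
  have vg: "v \<in> g" and xg: "x \<in> g" using v x T_subset_g M_subset_g by auto
  then have Jg: "J v \<in> g" "- J v \<in> g" "lie x (J v) \<in> g"
    using J_g subspace_neg[OF subspace_g] lie_g by auto
  have "differential M T (\<lambda>x. x) x v = v"
    by (rule orbit_differential[OF bounded_linear_ident refl x v])
  have R_add: "R (X + Y) = R X + R Y" and R_lie: "R (lie X Y) = lie (R X) (R Y)"
    and R_scale: "R (c *\<^sub>R X) = c *\<^sub>R R X" if "X \<in> g" "Y \<in> g" for X Y c
    using R(1) that by (auto simp: lie_representation_def)
  have dR: "differential M T R x v = R v"
    by (rule differential_representation[OF R(1) x v])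
  have D: "Dplus = \<i> *\<^sub>C R v + R (J v)" "Dminus = \<i> *\<^sub>C R v - R (J v)"
    using complex_extension_eq[OF vg Jg(1), of R] complex_extension_eq[OF vg Jg(2), of R]
      R_scale[OF Jg(1) Jg(1), of "-1"]
    by (simp_all add: Dplus_def Dminus_def \<open>differential M T (\<lambda>x. x) x v = v\<close> C_plus_def C_minus_def)
  have dual: "dual_map N (differential M T R) x v = R v + lie (R x) (R (J v))"
    using differential_representation[OF R(1) x nijenhuis_eq(1)[OF kks P\<^sub>0 x v]] vg xg Jg
    by (simp add: dual_map_def N_def nijenhuis_eq(2)[OF kks P\<^sub>0 x v] R_add R_lie)
  obtain A where "A \<in> g" "v = lie A x"
    using v by (auto simp: orbit_tangent_def)
  then have "R v = lie (R A) (R x)" using xg by (simp add: R_lie)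
  then have anticommutator: "R v ** R x + R x ** R v = (rp + rm) *\<^sub>C R v"
    using derivation_square[OF representation_square[OF R x]] by simp
  \<comment> \<open>This normalization makes both i (rp + rm) - 2 i rp and -i (rp + rm) + 2 i rm
    equal to 1, the coefficient of R v in \<open>dual\<close>.\<close>
  have "rp - rm = \<i>" using R(2) by (simp add: decomposable_def)
  then have rp: "rp = rm + \<i>" by (simp add: algebra_simps)
  have "Dminus ** R x + R x ** Dplus = \<i> *\<^sub>C (R v ** R x + R x ** R v) + lie (R x) (R (J v))"
    by (simp add: D lie_def matrix_ring_simps cscale_add)
  then show "dual_map N (differential M T R) x v =
      Dminus ** R x + R x ** Dplus - (2 * \<i> * rp) *\<^sub>C differential M T R x v"
    unfolding anticommutator dual dR by (simp add: rp vec_eq_iff algebra_simps)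
  have "- (Dplus ** R x) - R x ** Dminus = - \<i> *\<^sub>C (R v ** R x + R x ** R v) + lie (R x) (R (J v))"
    by (simp add: D lie_def matrix_ring_simps cscale_add cscale_uminus_left)
  then show "dual_map N (differential M T R) x v =
      - (Dplus ** R x) - R x ** Dminus + (2 * \<i> * rm) *\<^sub>C differential M T R x v"
    unfolding anticommutator dual dR by (simp add: rp vec_eq_iff algebra_simps)
qed

end

theorem theorem6p1:
  fixes gC g t G M :: "(complex^'n^'n) set"
    and Pos :: "(complex^'n^'n \<Rightarrow> complex) set"
    and \<phi> :: "complex^'n^'n \<Rightarrow> complex"
    and \<rho> :: "complex^'n^'n"
    and J \<mu> :: "complex^'n^'n \<Rightarrow> complex^'n^'n"
    and T :: "complex^'n^'n \<Rightarrow> (complex^'n^'n) set"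
    and \<pi>\<^sub>0 \<pi>\<^sub>k\<^sub>k\<^sub>s :: "(complex^'n^'n) bivector_field"
    and N :: "complex^'n^'n \<Rightarrow> complex^'n^'n \<Rightarrow> complex^'n^'n"
    and R \<mu>\<^sub>R :: "complex^'n^'n \<Rightarrow> complex^'m^'m"
    and d\<mu>\<^sub>R d\<mu>\<^sub>R_plus d\<mu>\<^sub>R_minus :: "complex^'n^'n \<Rightarrow> complex^'n^'n \<Rightarrow> complex^'m^'m"
    and rp rm :: complex
  assumes "complex_simple_lie_algebra gC" and "classical_type gC"
    and "g = compact_form gC" and "G = connected_group g"
    and "cartan_subalgebra g t"
    and "positive_system (roots gC t) Pos"
    and "noncompact_simple_root Pos \<phi>"
    and "\<rho> \<in> lie_center (isotropy_algebra gC t Pos \<phi>)" and "\<phi> \<rho> = \<i>"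
    and "M = adjoint_orbit G \<rho>" and "T = orbit_tangent g"
    and "is_J gC t Pos J"
    and "is_kks g M \<pi>\<^sub>k\<^sub>k\<^sub>s"
    and "poisson_structure M T \<pi>\<^sub>0"
    and "poisson_map G (group_tangent g) (poisson_lie g J) M T \<pi>\<^sub>0 (orbit_map \<rho>)"
    and "N = nijenhuis T \<pi>\<^sub>0 \<pi>\<^sub>k\<^sub>k\<^sub>s"
    and "lie_representation g R"
    and "decomposable R \<rho> rp rm"
    and "\<mu> = (\<lambda>x. x)" and "\<mu>\<^sub>R = (\<lambda>x. R (\<mu> x))"
    and "d\<mu>\<^sub>R = differential M T \<mu>\<^sub>R"
    and "d\<mu>\<^sub>R_plus = (\<lambda>x v. complex_extension R (C_plus J (differential M T \<mu> x v)))"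
    and "d\<mu>\<^sub>R_minus = (\<lambda>x v. complex_extension R (C_minus J (differential M T \<mu> x v)))"
  shows "\<forall>x\<in>M. \<forall>v\<in>T x.
           dual_map N d\<mu>\<^sub>R x v =
             d\<mu>\<^sub>R_minus x v ** \<mu>\<^sub>R x + \<mu>\<^sub>R x ** d\<mu>\<^sub>R_plus x v - (2 * \<i> * rp) *\<^sub>C d\<mu>\<^sub>R x v \<and>
           dual_map N d\<mu>\<^sub>R x v =
             - (d\<mu>\<^sub>R_plus x v ** \<mu>\<^sub>R x) - \<mu>\<^sub>R x ** d\<mu>\<^sub>R_minus x v + (2 * \<i> * rm) *\<^sub>C d\<mu>\<^sub>R x v"
proof -
  interpret hermitian_symmetric_data gC g t Pos \<phi> \<rho> J
    by unfold_locales (use assms in auto)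
  show ?thesis
    using nijenhuis_dual_representation[OF assms(17,18), of \<pi>\<^sub>k\<^sub>k\<^sub>s \<pi>\<^sub>0] assms(13,15)
    unfolding assms(4,10,11,16,19-23) by blast
qed

end
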